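(* Let $s$ be an integer, let $M$ be a $3$-connected matroid, let $\mathcal{T}$ be a tangle of $M$ of order $\theta\geq 6$, let $N$ be a minor of $M$ with no loops and no coloops, and let $t:=\rank_{\mathcal{T}}(E(N))$. If $\theta\geq 2s+t+1$, then there are disjoint sets $C,D\subseteq E(M)\setminus E(N)$ such that $M/C\setminus D$ is $3$-connected with $N$ as a minor, such that $\rank_{\mathcal{T}}(E(N)\cup C\cup D)=t+|C\cup D|$, and such that $|C\cup D|\geq s$.
   Context: $\lambda_M(X) = \rank_M(X) + \rank_M(E(M)\setminus X) - \rank(M)$. A tangle of order $\theta$ of $M$ is a collection $\mathcal{T}$ of subsets of $E(M)$ such that: (i) $\lambda_M(X)<\theta$ for all $X\in\mathcal{T}$; (ii) for every $X\subseteq E(M)$ with $\lambda_M(X)<\theta$, either $X\in\mathcal{T}$ or $E(M)\setminus X\in\mathcal{T}$; (iii) if $X,Y,Z\in\mathcal{T}$ then $X\cup Y\cup Z\neq E(M)$; (iv) $E(M)\setminus\{e\}\notin\mathcal{T}$ for every $e\in E(M)$. $\rank_{\mathcal{T}}$ is the rank function of the tangle matroid: $\rank_{\mathcal{T}}(X) = \min\{\lambda_M(Y): X\subseteq Y\in\mathcal{T}\}$ if some member of $\mathcal{T}$ contains $X$, and $\rank_{\mathcal{T}}(X)=\theta$ otherwise. "$M'$ has $N$ as a minor" means $N$ itself (with labelled ground set) equals $M'/C'\setminus D'$ for some disjoint $C',D'\subseteq E(M')$. *)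

theory Defs
  imports Main
begin

type_synonym 'a matroid = "'a set \<times> ('a set \<Rightarrow> bool)"

definition ground :: "'a matroid \<Rightarrow> 'a set" where
  "ground M = fst M"

definition indep :: "'a matroid \<Rightarrow> 'a set \<Rightarrow> bool" where
  "indep M = snd M"

definition matroid :: "'a matroid \<Rightarrow> bool" where
  "matroid M \<longleftrightarrow>
     finite (ground M) \<and>
     indep M {} \<and>
     (\<forall>X. indep M X \<longrightarrow> X \<subseteq> ground M) \<and>
     (\<forall>X Y. indep M Y \<and> X \<subseteq> Y \<longrightarrow> indep M X) \<and>
     (\<forall>X Y. indep M X \<and> indep M Y \<and> card X < card Y \<longrightarrow>
        (\<exists>e \<in> Y - X. indep M (insert e X)))"

definition rk :: "'a matroid \<Rightarrow> 'a set \<Rightarrow> nat" where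
  "rk M X = Max {card I | I. I \<subseteq> X \<and> indep M I}"

definition matroid_rank :: "'a matroid \<Rightarrow> nat" where
  "matroid_rank M = rk M (ground M)"

definition conn :: "'a matroid \<Rightarrow> 'a set \<Rightarrow> nat" where
  "conn M X = rk M X + rk M (ground M - X) - matroid_rank M"

definition delete :: "'a matroid \<Rightarrow> 'a set \<Rightarrow> 'a matroid" where
  "delete M D = (ground M - D, \<lambda>X. indep M X \<and> X \<inter> D = {})"

definition contract :: "'a matroid \<Rightarrow> 'a set \<Rightarrow> 'a matroid" where
  "contract M C = (ground M - C,
     \<lambda>X. X \<subseteq> ground M - C \<and> rk M (X \<union> C) = card X + rk M C)"

definition has_minor :: "'a matroid \<Rightarrow> 'a matroid \<Rightarrow> bool" where
  "has_minor M' N \<longleftrightarrow>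
     (\<exists>C' D'. C' \<subseteq> ground M' \<and> D' \<subseteq> ground M' \<and> C' \<inter> D' = {} \<and>
        N = delete (contract M' C') D')"

definition is_loop :: "'a matroid \<Rightarrow> 'a \<Rightarrow> bool" where
  "is_loop M e \<longleftrightarrow> e \<in> ground M \<and> \<not> indep M {e}"

definition is_coloop :: "'a matroid \<Rightarrow> 'a \<Rightarrow> bool" where
  "is_coloop M e \<longleftrightarrow> e \<in> ground M \<and> rk M (ground M - {e}) < matroid_rank M"

definition three_connected :: "'a matroid \<Rightarrow> bool" where
  "three_connected M \<longleftrightarrow> matroid M \<and>
     (\<forall>k X. 1 \<le> k \<and> k < (3::nat) \<and> X \<subseteq> ground M \<longrightarrow>
        \<not> (k \<le> card X \<and> k \<le> card (ground M - X) \<and> conn M X < k))"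

definition is_tangle :: "'a matroid \<Rightarrow> nat \<Rightarrow> 'a set set \<Rightarrow> bool" where
  "is_tangle M \<theta> T \<longleftrightarrow>
     (\<forall>X \<in> T. X \<subseteq> ground M) \<and>
     (\<forall>X \<in> T. conn M X < \<theta>) \<and>
     (\<forall>X. X \<subseteq> ground M \<and> conn M X < \<theta> \<longrightarrow> X \<in> T \<or> ground M - X \<in> T) \<and>
     (\<forall>X \<in> T. \<forall>Y \<in> T. \<forall>Z \<in> T. X \<union> Y \<union> Z \<noteq> ground M) \<and>
     (\<forall>e \<in> ground M. ground M - {e} \<notin> T)"

definition tangle_rank :: "'a matroid \<Rightarrow> nat \<Rightarrow> 'a set set \<Rightarrow> 'a set \<Rightarrow> nat" where
  "tangle_rank M \<theta> T X =
     (if \<exists>Y \<in> T. X \<subseteq> Y then Min {conn M Y | Y. Y \<in> T \<and> X \<subseteq> Y} else \<theta>)"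

end

theory Submission
  imports Defs
begin

text \<open>
  Elements are removed one at a time. Suppose \<open>M' = M/C \ D\<close> has been reached and \<open>k = |C \<union> D| < s\<close>.
  Then \<open>M'\<close> carries an induced tangle \<open>T'\<close> of order \<open>\<theta> - k\<close>, and a set \<open>Y \<in> T\<close> closed in the tangle
  matroid, containing \<open>E(N) \<union> C \<union> D\<close> and of connectivity \<open>t + k < \<theta> - k\<close>, restricts to a member of \<open>T'\<close>;
  let \<open>F\<close> be its closure for \<open>T'\<close>. An element outside \<open>F\<close> increases the tangle rank, and a
  3-separating member of \<open>T'\<close> not contained in \<open>F\<close> meets \<open>F\<close> in at most one element. So it suffices to find
  \<open>e \<notin> F\<close> such that \<open>M' \ e\<close> or \<open>M'/e\<close> is 3-connected and keeps \<open>N\<close>.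

  Suppose there is none. If \<open>M' \ e\<close> keeps \<open>N\<close> and \<open>e\<close> is in no triad, a minimal small side \<open>A\<close> of a
  2-separation of \<open>M' \ e\<close> has at least three elements and meets \<open>E(N)\<close> at most once, and the 2-sum structure together
  with Tutte's linking theorem yields \<open>g \<in> A - F\<close> such that both \<open>M' \ g\<close> and \<open>M'/g\<close> keep \<open>N\<close>.
  By Bixby's lemma and Tutte's triangle lemma this produces a four-element fan, as does, by two dual
  applications of the same fact, the case that no such \<open>g\<close> exists. Walking along the fan to an end
  that avoids \<open>F\<close>, Tutte's triangle lemma extends the fan for ever.
\<close>

section \<open>Rank functions, duality and linking\<close>

text \<open>Membership in \<open>F\<close> forbids removal, and \<open>E(N)\<close> lies in
  \<open>F\<close>. Closedness of \<open>F\<close> leaves room to move: every triangle, triad or fan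
  with an element outside \<open>F\<close> has at most one forbidden element, so a walk blocked at
  one end of a fan can turn to the other. Each removal uses two units of \<open>\<theta>\<close>: it
  raises the connectivity of \<open>Y\<close> by one and lowers the order of the induced tangle by
  one. With \<open>k \<le> s - 1\<close>, the bound \<open>2s + t + 1 \<le> \<theta>\<close> becomes
  \<open>t + 2k + 3 \<le> \<theta>\<close>, which places the restriction of \<open>Y\<close> in
  \<open>T'\<close> and gives \<open>T'\<close> order at least 3, so that \<open>T'\<close> decides
  all 3-separations. Since \<open>N\<close> itself must survive, the property of keeping
  \<open>N\<close> is carried from one element to another only by exchange in series and parallel
  pairs. The absence of loops and coloops in \<open>N\<close> rules out the cases in which this
  exchange would touch \<open>N\<close>. Everything up to the contradiction is phrased for integer
  rank functions, where duality is an explicit involution and each lemma about triads yields its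
  twin about triangles.\<close>

definition connf :: "'a set \<Rightarrow> ('a set \<Rightarrow> int) \<Rightarrow> 'a set \<Rightarrow> int" where
  "connf E r X = r X + r (E - X) - r E"

definition dual_rank :: "'a set \<Rightarrow> ('a set \<Rightarrow> int) \<Rightarrow> 'a set \<Rightarrow> int" where
  "dual_rank E r X = int (card (X \<inter> E)) + r (E - X) - r E"

definition triangle :: "'a set \<Rightarrow> ('a set \<Rightarrow> int) \<Rightarrow> 'a set \<Rightarrow> bool" where
  "triangle E r S \<longleftrightarrow> S \<subseteq> E \<and> card S = 3 \<and> r S \<le> 2"

definition triad :: "'a set \<Rightarrow> ('a set \<Rightarrow> int) \<Rightarrow> 'a set \<Rightarrow> bool" where
  "triad E r S \<longleftrightarrow> S \<subseteq> E \<and> card S = 3 \<and> r (E - S) + 1 \<le> r E"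

text \<open>Only 2-separations are excluded here; 1-separations are excluded automatically when the
  original matroid is 3-connected (\<open>del_3conn_connected\<close>, \<open>con_3conn_connected\<close>).\<close>

definition del_3conn :: "'a set \<Rightarrow> ('a set \<Rightarrow> int) \<Rightarrow> 'a \<Rightarrow> bool" where
  "del_3conn E r e \<longleftrightarrow>
     (\<forall>X \<subseteq> E - {e}. 2 \<le> card X \<longrightarrow> 2 \<le> card (E - {e} - X) \<longrightarrow>
        r (E - {e}) + 2 \<le> r X + r (E - {e} - X))"

text \<open>In the contraction of \<open>e\<close> both sides and the whole matroid lose
  \<open>r {e}\<close> of their rank; rewriting the inequality in terms of \<open>r\<close> leaves
  one \<open>r {e}\<close> on the left.\<close>

definition con_3conn :: "'a set \<Rightarrow> ('a set \<Rightarrow> int) \<Rightarrow> 'a \<Rightarrow> bool" where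
  "con_3conn E r e \<longleftrightarrow>
     (\<forall>X \<subseteq> E - {e}. 2 \<le> card X \<longrightarrow> 2 \<le> card (E - {e} - X) \<longrightarrow>
        r E + r {e} + 2 \<le> r (insert e X) + r (E - X))"

text \<open>The rank form of \<open>N = M/C \ (E - V - C)\<close>, where \<open>V\<close> is the ground set and \<open>\<rho>\<close> the rank
  function of \<open>N\<close>.\<close>

definition minor_rep ::
    "'a set \<Rightarrow> ('a set \<Rightarrow> int) \<Rightarrow> 'a set \<Rightarrow> ('a set \<Rightarrow> int) \<Rightarrow> 'a set \<Rightarrow> bool" where
  "minor_rep E r V \<rho> C \<longleftrightarrow> C \<subseteq> E - V \<and> (\<forall>X \<subseteq> V. r (X \<union> C) - r C = \<rho> X)"

definition del_keeps ::
    "'a set \<Rightarrow> ('a set \<Rightarrow> int) \<Rightarrow> 'a set \<Rightarrow> ('a set \<Rightarrow> int) \<Rightarrow> 'a \<Rightarrow> bool" where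
  "del_keeps E r V \<rho> e \<longleftrightarrow> (\<exists>C. minor_rep E r V \<rho> C \<and> e \<notin> C)"

definition con_keeps ::
    "'a set \<Rightarrow> ('a set \<Rightarrow> int) \<Rightarrow> 'a set \<Rightarrow> ('a set \<Rightarrow> int) \<Rightarrow> 'a \<Rightarrow> bool" where
  "con_keeps E r V \<rho> e \<longleftrightarrow> (\<exists>C. minor_rep E r V \<rho> C \<and> e \<in> C)"

text \<open>\<open>r_supp\<close> fixes the values on sets that leave \<open>E\<close>. This makes
  \<open>dual_rank\<close> an involution on functions, not merely on subsets of \<open>E\<close>, so
  statements can be dualised by rewriting.\<close>

locale rank_fun =
  fixes E :: "'a set" and r :: "'a set \<Rightarrow> int"
  assumes fin: "finite E"
    and r_empty: "r {} = 0"
    and r_mono: "X \<subseteq> Y \<Longrightarrow> r X \<le> r Y"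
    and r_submod: "r (X \<union> Y) + r (X \<inter> Y) \<le> r X + r Y"
    and r_single: "r {e} \<le> 1"
    and r_supp: "r (X \<inter> E) = r X"
begin

text \<open>Submodularity combined with monotonicity: the two sets on the left are named in whatever
  form is convenient, and only set inclusions remain to be checked.\<close>

lemma r_sub: "U \<subseteq> X \<union> Y \<Longrightarrow> I \<subseteq> X \<inter> Y \<Longrightarrow> r U + r I \<le> r X + r Y"
  using r_submod[of X Y] r_mono[of U "X \<union> Y"] r_mono[of I "X \<inter> Y"] by linarith

lemma r_insert: "r (insert e X) \<le> r X + 1"
  using r_sub[of "insert e X" X "{e}" "{}"] r_single[of e] r_empty by simp

lemma r_Un_card: "finite Y \<Longrightarrow> r (X \<union> Y) \<le> r X + int (card Y)"
proof (induction Y rule: finite_induct)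
  case (insert e Y)
  then show ?case using r_insert[of e "X \<union> Y"] by simp
qed simp

lemma r_card: "finite Y \<Longrightarrow> r Y \<le> int (card Y)"
  using r_Un_card[of Y "{}"] r_empty by simp

lemma r_remove: "X \<subseteq> insert e Y \<Longrightarrow> r X \<le> r Y + 1"
  using r_insert[of e Y] r_mono[of X "insert e Y"] by linarith

lemma connf_nonneg: "X \<subseteq> E \<Longrightarrow> 0 \<le> connf E r X"
  using r_sub[of E X "E - X" "{}"] r_empty unfolding connf_def by auto

lemma connf_le_card: "X \<subseteq> E \<Longrightarrow> connf E r X \<le> int (card X)"
  using r_card[of X] r_mono[of "E - X" E] finite_subset[of X E] fin unfolding connf_def by auto

lemma connf_compl: "X \<subseteq> E \<Longrightarrow> connf E r (E - X) = connf E r X"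
  unfolding connf_def by (simp add: double_diff)

lemma connf_submod:
  "connf E r (X \<union> Y) + connf E r (X \<inter> Y) \<le> connf E r X + connf E r Y"
proof -
  have "r (E - (X \<inter> Y)) + r (E - (X \<union> Y)) \<le> r (E - X) + r (E - Y)" by (rule r_sub) auto
  then show ?thesis using r_submod[of X Y] unfolding connf_def by linarith
qed

lemma connf_insert: "connf E r (insert e X) \<le> connf E r X + 1"
proof -
  have "r (E - insert e X) \<le> r (E - X)" by (rule r_mono) auto
  then show ?thesis using r_insert[of e X] unfolding connf_def by linarith
qed

lemma dual_dual: "dual_rank E (dual_rank E r) = r"
proof
  fix X
  have "card E = card (X \<inter> E) + card (E - X)"
    using card_Int_Diff[OF fin, of X] by (simp add: Int_commute)
  moreover have "E - (E - X) = X \<inter> E" "(E - X) \<inter> E = E - X" by auto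
  ultimately show "dual_rank E (dual_rank E r) X = r X"
    using r_empty r_supp[of X] unfolding dual_rank_def by simp
qed

lemma rank_fun_dual: "rank_fun E (dual_rank E r)"
proof
  show "finite E" by (rule fin)
  show "dual_rank E r {} = 0" unfolding dual_rank_def by simp
  show "dual_rank E r X \<le> dual_rank E r Y" if "X \<subseteq> Y" for X Y
  proof -
    have "r (E - X) \<le> r (E - Y) + int (card (Y \<inter> E - X \<inter> E))"
    proof -
      have "r (E - X) \<le> r ((E - Y) \<union> (Y \<inter> E - X \<inter> E))" by (rule r_mono) auto
      also have "\<dots> \<le> r (E - Y) + int (card (Y \<inter> E - X \<inter> E))"
        using fin by (intro r_Un_card) auto
      finally show ?thesis .
    qed
    moreover have "card (Y \<inter> E - X \<inter> E) = card (Y \<inter> E) - card (X \<inter> E)"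
      using fin that by (intro card_Diff_subset) auto
    moreover have "card (X \<inter> E) \<le> card (Y \<inter> E)" using fin that by (intro card_mono) auto
    ultimately show ?thesis unfolding dual_rank_def by linarith
  qed
  show "dual_rank E r (X \<union> Y) + dual_rank E r (X \<inter> Y) \<le> dual_rank E r X + dual_rank E r Y"
    for X Y
  proof -
    have "card (X \<inter> E) + card (Y \<inter> E) = card ((X \<inter> E) \<union> (Y \<inter> E)) + card ((X \<inter> E) \<inter> (Y \<inter> E))"
      using fin by (intro card_Un_Int) auto
    moreover have "(X \<inter> E) \<union> (Y \<inter> E) = (X \<union> Y) \<inter> E" "(X \<inter> E) \<inter> (Y \<inter> E) = (X \<inter> Y) \<inter> E" by auto
    moreover have "r (E - (X \<inter> Y)) + r (E - (X \<union> Y)) \<le> r (E - X) + r (E - Y)"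
      by (rule r_sub) auto
    ultimately show ?thesis unfolding dual_rank_def by simp
  qed
  show "dual_rank E r {e} \<le> 1" for e
    using r_mono[of "E - {e}" E] card_mono[of "{e}" "{e} \<inter> E"] unfolding dual_rank_def by auto
  show "dual_rank E r (X \<inter> E) = dual_rank E r X" for X
    unfolding dual_rank_def by (simp add: Diff_Int)
qed

lemma connf_dual: "X \<subseteq> E \<Longrightarrow> connf E (dual_rank E r) X = connf E r X"
proof -
  assume X: "X \<subseteq> E"
  have "card E = card X + card (E - X)"
    using card_Int_Diff[OF fin, of X] X by (simp add: Int_absorb1)
  moreover have "E - (E - X) = X" "(E - X) \<inter> E = E - X" "X \<inter> E = X" using X by auto
  ultimately show ?thesis using r_empty unfolding connf_def dual_rank_def by simp
qed

lemma triangle_dual: "triangle E (dual_rank E r) S \<longleftrightarrow> triad E r S"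
proof (cases "S \<subseteq> E \<and> card S = 3")
  case True
  then show ?thesis by (auto simp: triangle_def triad_def dual_rank_def Int_absorb2)
qed (auto simp: triangle_def triad_def)

lemma del_3conn_dual:
  assumes "e \<in> E" shows "del_3conn E (dual_rank E r) e \<longleftrightarrow> con_3conn E r e"
proof -
  have "(dual_rank E r (E - {e}) + 2 \<le> dual_rank E r X + dual_rank E r (E - {e} - X))
      = (r E + r {e} + 2 \<le> r (insert e X) + r (E - X))" if X: "X \<subseteq> E - {e}" for X
  proof -
    have "card (E - {e}) = card X + card (E - {e} - X)"
      using card_Int_Diff[of "E - {e}" X] fin X by (simp add: Int_absorb1)
    moreover have "E - (E - {e}) = {e}" "E - (E - {e} - X) = insert e X" "X \<inter> E = X"
      "(E - {e}) \<inter> E = E - {e}" "(E - {e} - X) \<inter> E = E - {e} - X" using X assms by auto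
    ultimately show ?thesis unfolding dual_rank_def by auto
  qed
  then show ?thesis unfolding del_3conn_def con_3conn_def by blast
qed

text \<open>The dual of a minor contracts what the minor deletes, namely
  \<open>E - V - C\<close>.\<close>

lemma minor_rep_dual:
  assumes "V \<subseteq> E" "minor_rep E r V \<rho> C"
  shows "minor_rep E (dual_rank E r) V (dual_rank V \<rho>) (E - V - C)"
  unfolding minor_rep_def
proof (intro conjI allI impI)
  fix X assume X: "X \<subseteq> V"
  have C: "C \<subseteq> E - V" and rep: "\<And>Y. Y \<subseteq> V \<Longrightarrow> r (Y \<union> C) - r C = \<rho> Y"
    using assms(2) unfolding minor_rep_def by auto
  have fX: "finite X" "finite (E - V - C)" 
    using fin finite_subset[OF X finite_subset[OF assms(1) fin]] by auto
  have "card (X \<union> (E - V - C)) = card X + card (E - V - C)"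
    using fX X by (intro card_Un_disjoint) auto
  moreover have "(X \<union> (E - V - C)) \<inter> E = X \<union> (E - V - C)" "(E - V - C) \<inter> E = E - V - C"
    "X \<inter> V = X" "E - (X \<union> (E - V - C)) = (V - X) \<union> C" "E - (E - V - C) = V \<union> C"
    using X C assms(1) by auto
  ultimately show "dual_rank E r (X \<union> (E - V - C)) - dual_rank E r (E - V - C) = dual_rank V \<rho> X"
    using rep[of "V - X"] rep[of V] unfolding dual_rank_def by simp
qed auto

lemma del_keeps_dual_imp:
  assumes "V \<subseteq> E" "e \<in> E - V"
  shows "del_keeps E r V \<rho> e \<Longrightarrow> con_keeps E (dual_rank E r) V (dual_rank V \<rho>) e"
    and "con_keeps E r V \<rho> e \<Longrightarrow> del_keeps E (dual_rank E r) V (dual_rank V \<rho>) e"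
proof -
  assume "del_keeps E r V \<rho> e"
  then obtain C where "minor_rep E r V \<rho> C" "e \<notin> C" unfolding del_keeps_def by auto
  then show "con_keeps E (dual_rank E r) V (dual_rank V \<rho>) e"
    using minor_rep_dual[OF assms(1)] assms(2) unfolding con_keeps_def by blast
next
  assume "con_keeps E r V \<rho> e"
  then obtain C where "minor_rep E r V \<rho> C" "e \<in> C" unfolding con_keeps_def by auto
  then show "del_keeps E (dual_rank E r) V (dual_rank V \<rho>) e"
    using minor_rep_dual[OF assms(1)] assms(2) unfolding del_keeps_def by blast
qed

end

text \<open>Tutte's linking theorem between \<open>P\<close> and \<open>Q\<close>, relative to an already contracted set \<open>Z\<close>.\<close>

lemma linking:
  assumes "rank_fun E r" "finite S"
    and "\<And>X. X \<subseteq> S \<Longrightarrow>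
      k + r (P \<union> Q \<union> S \<union> Z) + r Z \<le> r (P \<union> X \<union> Z) + r (Q \<union> (S - X) \<union> Z)"
  shows "\<exists>Z'. Z \<subseteq> Z' \<and> Z' \<subseteq> Z \<union> S \<and> k + r (P \<union> Q \<union> Z') + r Z' \<le> r (P \<union> Z') + r (Q \<union> Z')"
  using assms(2,3)
proof (induction S arbitrary: Z rule: finite_induct)
  case empty
  then show ?case using empty.prems[of "{}"] by (intro exI[of _ Z]) auto
next
  case (insert s S)
  interpret rank_fun E r by (rule assms(1))
  let ?H = "\<lambda>Z. \<forall>X \<subseteq> S. k + r (P \<union> Q \<union> S \<union> Z) + r Z \<le> r (P \<union> X \<union> Z) + r (Q \<union> (S - X) \<union> Z)"
  have "?H Z \<or> ?H (insert s Z)"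
  \<comment> \<open>\<open>X1\<close> violates the condition with \<open>s\<close> left
    uncontracted, \<open>X2\<close> the one with \<open>s\<close> contracted. Uncrossing them gives
    two cuts \<open>?I\<close> and \<open>?U\<close> of \<open>insert s S\<close>, and both obey the
    hypothesis. The two strict inequalities lose 2 in total while \<open>r (insert s Z)\<close>
    regains at most 1, so the sums contradict each other by one unit.\<close>
  proof (rule ccontr)
    assume "\<not> (?H Z \<or> ?H (insert s Z))"
    then obtain X1 X2 where X: "X1 \<subseteq> S" "X2 \<subseteq> S"
      and 1: "r (P \<union> X1 \<union> Z) + r (Q \<union> (S - X1) \<union> Z) < k + r (P \<union> Q \<union> S \<union> Z) + r Z"
      and 2: "r (P \<union> X2 \<union> insert s Z) + r (Q \<union> (S - X2) \<union> insert s Z)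
        < k + r (P \<union> Q \<union> S \<union> insert s Z) + r (insert s Z)" by (meson not_le)
    let ?I = "X1 \<inter> X2" and ?U = "insert s (X1 \<union> X2)"
    have "r (P \<union> ?U \<union> Z) + r (P \<union> ?I \<union> Z) \<le> r (P \<union> X1 \<union> Z) + r (P \<union> X2 \<union> insert s Z)"
      by (rule r_sub) auto
    moreover have "r (Q \<union> (insert s S - ?I) \<union> Z) + r (Q \<union> (insert s S - ?U) \<union> Z)
        \<le> r (Q \<union> (S - X1) \<union> Z) + r (Q \<union> (S - X2) \<union> insert s Z)"
      by (rule r_sub) auto
    moreover have "k + r (P \<union> Q \<union> insert s S \<union> Z) + r Z
        \<le> r (P \<union> ?I \<union> Z) + r (Q \<union> (insert s S - ?I) \<union> Z)"
      using X by (intro insert.prems) auto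
    moreover have "k + r (P \<union> Q \<union> insert s S \<union> Z) + r Z
        \<le> r (P \<union> ?U \<union> Z) + r (Q \<union> (insert s S - ?U) \<union> Z)"
      using X by (intro insert.prems) auto
    moreover have "r (P \<union> Q \<union> S \<union> Z) \<le> r (P \<union> Q \<union> insert s S \<union> Z)" by (rule r_mono) auto
    moreover have "P \<union> Q \<union> S \<union> insert s Z = P \<union> Q \<union> insert s S \<union> Z" by auto
    moreover have "r (insert s Z) \<le> r Z + 1" by (rule r_insert)
    ultimately show False using 1 2 by simp
  qed
  then show ?case
  proof
    assume "?H Z"
    then obtain Z' where "Z \<subseteq> Z'" "Z' \<subseteq> Z \<union> S"
      "k + r (P \<union> Q \<union> Z') + r Z' \<le> r (P \<union> Z') + r (Q \<union> Z')"
      using insert.IH[of Z] by blast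
    then show ?thesis by blast
  next
    assume "?H (insert s Z)"
    then obtain Z' where "insert s Z \<subseteq> Z'" "Z' \<subseteq> insert s Z \<union> S"
      "k + r (P \<union> Q \<union> Z') + r Z' \<le> r (P \<union> Z') + r (Q \<union> Z')"
      using insert.IH[of "insert s Z"] by blast
    then show ?thesis by blast
  qed
qed

lemma card3_distinct: "card {a, b, c} = 3 \<longleftrightarrow> a \<noteq> b \<and> a \<noteq> c \<and> b \<noteq> c"
  by (auto simp: card_insert_if)

lemma two_le_card_obtain:
  assumes "2 \<le> card X" obtains a b where "a \<in> X" "b \<in> X" "a \<noteq> b"
proof -
  obtain Y where "Y \<subseteq> X" "card Y = 2" using obtain_subset_with_card_n[OF assms] by blast
  then show ?thesis using that by (auto simp: card_2_iff)
qed

lemma two_le_card: "finite X \<Longrightarrow> a \<in> X \<Longrightarrow> b \<in> X \<Longrightarrow> a \<noteq> b \<Longrightarrow> 2 \<le> card X"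
  using card_mono[of X "{a, b}"] by auto

lemma card_le_1: "finite X \<Longrightarrow> card X \<le> 1 \<Longrightarrow> a \<in> X \<Longrightarrow> b \<in> X \<Longrightarrow> a = b"
  using two_le_card[of X a b] by linarith

section \<open>Removing an element from a 3-connected matroid\<close>

text \<open>Only the decisions of the tangle on sets of connectivity at most 2 are recorded, so the
  order of the induced tangle enters solely as a bound from below by 3.\<close>

locale tangle3 = rank_fun E r for E :: "'a set" and r +
  fixes T :: "'a set set" and F :: "'a set"
  assumes conn3: "X \<subseteq> E \<Longrightarrow> 2 \<le> card X \<Longrightarrow> 2 \<le> card (E - X) \<Longrightarrow> 2 \<le> connf E r X"
    and T_sub: "X \<in> T \<Longrightarrow> X \<subseteq> E"
    and T_or: "X \<subseteq> E \<Longrightarrow> connf E r X \<le> 2 \<Longrightarrow> X \<in> T \<or> E - X \<in> T"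
    and T_cover: "X \<in> T \<Longrightarrow> Y \<in> T \<Longrightarrow> Z \<in> T \<Longrightarrow> X \<union> Y \<union> Z \<noteq> E"
    and T_co1: "e \<in> E \<Longrightarrow> E - {e} \<notin> T"
    and F_T: "F \<in> T"
begin

lemma T_subset: "X \<subseteq> Y \<Longrightarrow> Y \<in> T \<Longrightarrow> connf E r X \<le> 2 \<Longrightarrow> X \<in> T"
  using T_or[of X] T_sub[of Y] T_cover[of Y "E - X" Y] by blast

lemma T_single: "e \<in> E \<Longrightarrow> {e} \<in> T"
  using T_or[of "{e}"] connf_le_card[of "{e}"] T_co1[of e] by auto

text \<open>Otherwise the complement of \<open>insert e A\<close> is small, and with
  \<open>A\<close> and \<open>{e}\<close> it covers \<open>E\<close>.\<close>

lemma T_insert: "A \<in> T \<Longrightarrow> e \<in> E \<Longrightarrow> connf E r (insert e A) \<le> 2 \<Longrightarrow> insert e A \<in> T"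
  using T_or[of "insert e A"] T_sub[of A] T_cover[of A "{e}" "E - insert e A"] T_single[of e]
  by blast

lemma T_compl_big: assumes "X \<in> T" shows "2 \<le> card (E - X)"
proof (rule ccontr)
  assume "\<not> 2 \<le> card (E - X)"
  then have "card (E - X) = 0 \<or> card (E - X) = 1" by linarith
  then show False
  proof
    assume "card (E - X) = 0"
    then have "X = E" using T_sub[OF assms] fin by auto
    then show False using T_cover[OF assms assms assms] by simp
  next
    assume "card (E - X) = 1"
    then obtain e where e: "E - X = {e}" by (auto simp: card_1_singleton_iff)
    then have "X = E - {e}" "e \<in> E" using T_sub[OF assms] by auto
    then show False using T_co1[of e] assms by simp
  qed
qed

lemma T_pair: assumes "a \<in> E" "b \<in> E" shows "{a, b} \<in> T"
proof -
  have "card {b, a} \<le> 2" by (simp add: card_insert_if)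
  then have "connf E r {b, a} \<le> 2" using connf_le_card[of "{b, a}"] assms by simp
  then show ?thesis using T_insert[OF T_single[OF assms(2)] assms(1)] by (simp add: insert_commute)
qed

text \<open>Pairs are small, so two disjoint pairs fail to cover \<open>E\<close> and a fifth
  element exists. This guarantees that the complement of a triad has at least two elements.\<close>

lemma card_E: "5 \<le> card E"
proof -
  obtain a b where ab: "a \<in> E" "b \<in> E" "a \<noteq> b"
    using two_le_card_obtain[OF T_compl_big[OF F_T]] by blast
  obtain c d where cd: "c \<in> E - {a, b}" "d \<in> E - {a, b}" "c \<noteq> d"
    using two_le_card_obtain[OF T_compl_big[OF T_pair[OF ab(1,2)]]] by blast
  have "{a, b} \<union> {c, d} \<union> {c, d} \<noteq> E"
    using T_cover T_pair ab cd by blast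
  then obtain f where f: "f \<in> E" "f \<notin> {a, b, c, d}" using ab cd by blast
  then have "card {a, b, c, d, f} = 5" using ab cd by auto
  moreover have "{a, b, c, d, f} \<subseteq> E" using ab cd f by auto
  ultimately show ?thesis using card_mono[OF fin] by metis
qed

text \<open>Simplicity and cosimplicity at once: connectivity 2 of a pair leaves no slack in
  \<open>r {a, b} \<le> 2\<close> or in \<open>r (E - {a, b}) \<le> r E\<close>.\<close>

lemma pair_rank:
  assumes "a \<in> E" "b \<in> E" "a \<noteq> b" shows "r {a, b} = 2" "r (E - {a, b}) = r E"
proof -
  have "2 \<le> connf E r {a, b}"
    using assms T_compl_big[OF T_pair[OF assms(1,2)]] by (intro conn3) simp_all
  moreover have "r (E - {a, b}) \<le> r E" by (rule r_mono) auto
  moreover have "r {a, b} \<le> 2" using r_card[of "{a, b}"] assms by simp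
  ultimately show "r {a, b} = 2" "r (E - {a, b}) = r E" unfolding connf_def by auto
qed

lemma single_rank: assumes "a \<in> E" shows "r {a} = 1" "r (E - {a}) = r E"
proof -
  obtain b where b: "b \<in> E" "b \<noteq> a"
    using two_le_card_obtain[OF T_compl_big[OF T_single[OF assms]]] by blast
  have "r {a, b} \<le> r {a} + 1" by (rule r_remove[of _ b]) auto
  then show "r {a} = 1" using r_single[of a] pair_rank[OF assms b(1)] b(2) by auto
  have "r (E - {a, b}) \<le> r (E - {a})" "r (E - {a}) \<le> r E" by (auto intro: r_mono)
  then show "r (E - {a}) = r E" using pair_rank[OF assms b(1)] b(2) by auto
qed

text \<open>Sides with a single element are settled by \<open>pair_rank\<close>, applied to that
  element and \<open>e\<close>; all other sides fall under \<open>del_3conn\<close>.\<close>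

lemma del_3conn_connected:
  assumes "del_3conn E r e" "e \<in> E" "X \<subseteq> E - {e}" "1 \<le> card X" "1 \<le> card (E - {e} - X)"
  shows "r (E - {e}) + 1 \<le> r X + r (E - {e} - X)"
proof -
  have one: "r (E - {e}) + 1 \<le> r X + r (E - {e} - X)" if X: "X \<subseteq> E - {e}" "card X = 1" for X
  proof -
    obtain x where x: "X = {x}" using X(2) by (auto simp: card_1_singleton_iff)
    then have "x \<in> E" "x \<noteq> e" "E - {e} - X = E - {e, x}" using X(1) by auto
    then show ?thesis
      using x single_rank[of x] single_rank[of e] pair_rank[of e x] assms(2) by simp
  qed
  have eq: "E - {e} - (E - {e} - X) = X" using assms(3) by auto
  consider "card X = 1" | "card (E - {e} - X) = 1" | "2 \<le> card X" "2 \<le> card (E - {e} - X)"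
    using assms(4,5) by linarith
  then show ?thesis
  proof cases
    case 1
    then show ?thesis by (rule one[OF assms(3)])
  next
    case 2
    then have "r (E - {e}) + 1 \<le> r (E - {e} - X) + r (E - {e} - (E - {e} - X))"
      by (intro one) auto
    then show ?thesis unfolding eq by linarith
  next
    case 3
    then have "r (E - {e}) + 2 \<le> r X + r (E - {e} - X)"
      using assms(1,3) unfolding del_3conn_def by blast
    then show ?thesis by linarith
  qed
qed

lemma con_3conn_connected:
  assumes "con_3conn E r e" "e \<in> E" "X \<subseteq> E - {e}" "1 \<le> card X" "1 \<le> card (E - {e} - X)"
  shows "r E + r {e} + 1 \<le> r (insert e X) + r (E - X)"
proof -
  have one: "r E + r {e} + 1 \<le> r (insert e X) + r (E - X)" if X: "X \<subseteq> E - {e}" "card X = 1" for X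
  proof -
    obtain x where x: "X = {x}" using X(2) by (auto simp: card_1_singleton_iff)
    then have "x \<in> E" "x \<noteq> e" using X(1) by auto
    then show ?thesis
      using x single_rank[of x] single_rank[of e] pair_rank[of e x] assms(2) by simp
  qed
  have eq: "insert e (E - {e} - X) = E - X" "E - (E - {e} - X) = insert e X" using assms(2,3) by auto
  consider "card X = 1" | "card (E - {e} - X) = 1" | "2 \<le> card X" "2 \<le> card (E - {e} - X)"
    using assms(4,5) by linarith
  then show ?thesis
  proof cases
    case 1
    then show ?thesis by (rule one[OF assms(3)])
  next
    case 2
    then have "r E + r {e} + 1 \<le> r (insert e (E - {e} - X)) + r (E - (E - {e} - X))"
      by (intro one) auto
    then show ?thesis unfolding eq by linarith
  next
    case 3
    then have "r E + r {e} + 2 \<le> r (insert e X) + r (E - X)"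
      using assms(1,3) unfolding con_3conn_def by blast
    then show ?thesis by linarith
  qed
qed

end

text \<open>The hypothetical counterexample: no element outside \<open>F\<close> can be removed. All assumptions are
  invariant under duality (\<open>stuck_dual\<close>), so every fact below is also available in dual form.\<close>

locale stuck_minor = tangle3 E r T F for E :: "'a set" and r and T and F +
  fixes V :: "'a set" and \<rho> :: "'a set \<Rightarrow> int"
  assumes rho: "rank_fun V \<rho>"
    and VF: "V \<subseteq> F"
    and F_line: "L \<in> T \<Longrightarrow> connf E r L \<le> 2 \<Longrightarrow> 2 \<le> card (L \<inter> F) \<Longrightarrow> L \<subseteq> F"
    and no_loop: "x \<in> V \<Longrightarrow> 1 \<le> \<rho> {x}"
    and no_coloop: "x \<in> V \<Longrightarrow> \<rho> V \<le> \<rho> (V - {x})"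
    and ex_rep: "\<exists>C. minor_rep E r V \<rho> C"
    and stuck_del: "e \<in> E - F \<Longrightarrow> del_keeps E r V \<rho> e \<Longrightarrow> \<not> del_3conn E r e"
    and stuck_con: "e \<in> E - F \<Longrightarrow> con_keeps E r V \<rho> e \<Longrightarrow> \<not> con_3conn E r e"
begin

lemma F_E: "F \<subseteq> E" using F_T T_sub by blast
lemma V_E: "V \<subseteq> E" using F_E VF by blast

lemma triad_dual: "triad E (dual_rank E r) S \<longleftrightarrow> triangle E r S"
  using rank_fun.triangle_dual[OF rank_fun_dual] by (simp add: dual_dual)

lemma con_3conn_dual: "e \<in> E \<Longrightarrow> con_3conn E (dual_rank E r) e \<longleftrightarrow> del_3conn E r e"
  using rank_fun.del_3conn_dual[OF rank_fun_dual] by (simp add: dual_dual)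

lemma keeps_dual:
  assumes "e \<in> E - V"
  shows "del_keeps E (dual_rank E r) V (dual_rank V \<rho>) e \<longleftrightarrow> con_keeps E r V \<rho> e"
    and "con_keeps E (dual_rank E r) V (dual_rank V \<rho>) e \<longleftrightarrow> del_keeps E r V \<rho> e"
  using del_keeps_dual_imp[OF V_E assms, of \<rho>]
    rank_fun.del_keeps_dual_imp[OF rank_fun_dual V_E assms, of "dual_rank V \<rho>"]
  by (auto simp: dual_dual rank_fun.dual_dual[OF rho])

text \<open>\<open>T\<close> and \<open>F\<close> stay the same because connectivity is self-dual;
  loops trade places with coloops and deletion with contraction.\<close>

lemma stuck_dual: "stuck_minor E (dual_rank E r) T F V (dual_rank V \<rho>)"
proof (intro stuck_minor.intro tangle3.intro tangle3_axioms.intro stuck_minor_axioms.intro)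
  show "rank_fun E (dual_rank E r)" by (rule rank_fun_dual)
  show "rank_fun V (dual_rank V \<rho>)" by (rule rank_fun.rank_fun_dual[OF rho])
  show "V \<subseteq> F" by (rule VF)
  show "2 \<le> connf E (dual_rank E r) X" if "X \<subseteq> E" "2 \<le> card X" "2 \<le> card (E - X)" for X
    using conn3[OF that] that by (simp add: connf_dual)
  show "X \<in> T \<or> E - X \<in> T" if "X \<subseteq> E" "connf E (dual_rank E r) X \<le> 2" for X
    using T_or that by (simp add: connf_dual)
  show "L \<subseteq> F" if "L \<in> T" "connf E (dual_rank E r) L \<le> 2" "2 \<le> card (L \<inter> F)" for L
    using F_line T_sub that by (simp add: connf_dual)
  show "1 \<le> dual_rank V \<rho> {x}" if "x \<in> V" for x
    using no_coloop[OF that] that unfolding dual_rank_def by simp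
  show "dual_rank V \<rho> V \<le> dual_rank V \<rho> (V - {x})" if "x \<in> V" for x
  proof -
    have "finite V" using V_E fin finite_subset by blast
    then have "card V = Suc (card (V - {x}))" using that card_Suc_Diff1 by metis
    moreover have "V - (V - {x}) = {x}" "(V - {x}) \<inter> V = V - {x}" using that by auto
    ultimately show ?thesis
      using no_loop[OF that] rank_fun.r_empty[OF rho] unfolding dual_rank_def by simp
  qed
  show "\<exists>C. minor_rep E (dual_rank E r) V (dual_rank V \<rho>) C"
    using ex_rep minor_rep_dual[OF V_E] by blast
  show "\<not> del_3conn E (dual_rank E r) e" if "e \<in> E - F"
    "del_keeps E (dual_rank E r) V (dual_rank V \<rho>) e" for e
    using that stuck_con[of e] keeps_dual[of e] VF del_3conn_dual[of e] by auto
  show "\<not> con_3conn E (dual_rank E r) e" if "e \<in> E - F"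
    "con_keeps E (dual_rank E r) V (dual_rank V \<rho>) e" for e
    using that stuck_del[of e] keeps_dual[of e] VF con_3conn_dual[of e] by auto
qed (use T_sub T_cover T_co1 F_T in auto)

section \<open>Triads, triangles and the transfer of the minor between their elements\<close>

text \<open>Once \<open>w\<close> is deleted, the other two elements form a series pair, which is
  one side of a 2-separation.\<close>

lemma triad_not_del:
  assumes "triad E r S" "w \<in> S" shows "\<not> del_3conn E r w"
proof
  assume del: "del_3conn E r w"
  have S: "S \<subseteq> E" "card S = 3" "r (E - S) + 1 \<le> r E" using assms(1) unfolding triad_def by auto
  have fS: "finite S" using S(1) fin finite_subset by blast
  have c: "card (S - {w}) = 2" using S(2) assms(2) fS by simp
  have eq: "E - {w} - (S - {w}) = E - S" using assms(2) by auto
  have "card (E - S) = card E - 3" using card_Diff_subset[OF fS S(1)] S(2) by simp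
  then have "2 \<le> card (E - S)" using card_E by simp
  then have "r (E - {w}) + 2 \<le> r (S - {w}) + r (E - S)"
    using del c S(1) unfolding del_3conn_def eq[symmetric] by (metis Diff_mono order_refl)
  moreover have "r (S - {w}) \<le> 2" using r_card[of "S - {w}"] c fS by simp
  ultimately show False using S single_rank[of w] assms(2) by auto
qed

lemma triangle_not_con:
  assumes "triangle E r S" "w \<in> S" shows "\<not> con_3conn E r w"
proof -
  interpret D: stuck_minor E "dual_rank E r" T F V "dual_rank V \<rho>" by (rule stuck_dual)
  have "w \<in> E" using assms unfolding triangle_def by auto
  then show ?thesis using D.triad_not_del[of S w] assms by (simp add: triad_dual del_3conn_dual)
qed

lemma not_del_obtain:
  assumes "e \<in> E" "\<not> del_3conn E r e"
  obtains X where "X \<subseteq> E - {e}" "2 \<le> card X" "2 \<le> card (E - {e} - X)"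
    "r X + r (E - {e} - X) \<le> r E + 1"
proof -
  obtain X where "X \<subseteq> E - {e}" "2 \<le> card X" "2 \<le> card (E - {e} - X)"
    and "\<not> r (E - {e}) + 2 \<le> r X + r (E - {e} - X)"
    using assms(2) unfolding del_3conn_def by auto
  then show ?thesis using that[of X] single_rank[OF assms(1)] by simp
qed

lemma not_con_obtain:
  assumes "e \<in> E" "\<not> con_3conn E r e"
  obtains X where "X \<subseteq> E - {e}" "2 \<le> card X" "2 \<le> card (E - {e} - X)"
    "r (insert e X) + r (E - X) \<le> r E + 2"
proof -
  obtain X where "X \<subseteq> E - {e}" "2 \<le> card X" "2 \<le> card (E - {e} - X)"
    and "\<not> r E + r {e} + 2 \<le> r (insert e X) + r (E - X)"
    using assms(2) unfolding con_3conn_def by auto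
  then show ?thesis using that[of X] single_rank[OF assms(1)] by simp
qed

text \<open>Restoring \<open>e\<close> costs at most one, so both sides have connectivity at most 2
  in the whole matroid. If the given side is not small, its complement is, and this contains the
  other side.\<close>

lemma small_two_separation:
  assumes "e \<in> E" "\<not> del_3conn E r e"
  obtains A where "A \<in> T" "e \<notin> A" "2 \<le> card A" "r A + r (E - {e} - A) \<le> r E + 1"
proof -
  obtain X where X: "X \<subseteq> E - {e}" "2 \<le> card X" "2 \<le> card (E - {e} - X)"
    "r X + r (E - {e} - X) \<le> r E + 1" using not_del_obtain[OF assms] .
  let ?Y = "E - {e} - X"
  have "r (E - X) \<le> r ?Y + 1" "r (E - ?Y) \<le> r X + 1" by (rule r_remove[of _ e], blast)+
  then have c: "connf E r X \<le> 2" "connf E r ?Y \<le> 2" using X(4) unfolding connf_def by linarith+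
  show ?thesis
  proof (cases "X \<in> T")
    case True
    then show ?thesis using X that by blast
  next
    case False
    then have "E - X \<in> T" using T_or c X by blast
    then have "?Y \<in> T" using T_subset[of ?Y "E - X"] c by blast
    moreover have "E - {e} - ?Y = X" using X by auto
    ultimately show ?thesis using X that[of ?Y] by simp
  qed
qed

text \<open>\<open>z\<close> lies in the coclosure of \<open>Y\<close>: moving it out of the
  complement lowers the rank there by one, which pays for the possible increase of
  \<open>r Y\<close>.\<close>

lemma triad_Un_conn:
  assumes "triad E r {u, w, z}" "u \<in> Y" "w \<in> Y" "z \<notin> Y" "Y \<subseteq> E"
  shows "connf E r (insert z Y) \<le> connf E r Y"
proof -
  have t: "u \<in> E" "w \<in> E" "z \<in> E" "u \<noteq> w" "r (E - {u, w, z}) + 1 \<le> r E"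
    using assms(1) unfolding triad_def card3_distinct by auto
  have "r (E - {u, w}) + r (E - insert z Y) \<le> r (E - Y) + r (E - {u, w, z})"
    using assms by (intro r_sub) auto
  then have "r (E - insert z Y) + 1 \<le> r (E - Y)" using pair_rank[of u w] t by simp
  then show ?thesis using r_insert[of z Y] unfolding connf_def by linarith
qed

lemma triangle_Un_conn:
  assumes "triangle E r {u, w, z}" "u \<in> Y" "w \<in> Y" "z \<notin> Y" "Y \<subseteq> E"
  shows "connf E r (insert z Y) \<le> connf E r Y"
proof -
  interpret D: stuck_minor E "dual_rank E r" T F V "dual_rank V \<rho>" by (rule stuck_dual)
  have "z \<in> E" using assms unfolding triangle_def by auto
  then show ?thesis
    using D.triad_Un_conn[of u w z Y] assms by (simp add: triad_dual connf_dual)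
qed

lemma triad_conn:
  assumes "triad E r S" shows "connf E r S \<le> 2" "S \<in> T"
proof -
  have "finite S" using assms fin finite_subset unfolding triad_def by blast
  then show c: "connf E r S \<le> 2" using r_card[of S] assms unfolding triad_def connf_def by auto
  obtain a b c where S: "S = {a, b, c}" using assms card_3_iff unfolding triad_def by metis
  then show "S \<in> T"
    using T_insert[OF T_pair[of b c], of a] c assms unfolding triad_def by auto
qed

lemma triangle_conn:
  assumes "triangle E r S" shows "connf E r S \<le> 2" "S \<in> T"
proof -
  interpret D: stuck_minor E "dual_rank E r" T F V "dual_rank V \<rho>" by (rule stuck_dual)
  show "connf E r S \<le> 2" "S \<in> T"
    using D.triad_conn[of S] assms unfolding triad_dual
    by (auto simp: triangle_def connf_dual)
qed

text \<open>Otherwise \<open>b\<close> and \<open>c\<close> would span \<open>a\<close> from inside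
  \<open>E - S\<close>, so \<open>insert a (E - S)\<close> would not have full rank. But only two
  elements are missing from it, against cosimplicity.\<close>

lemma orthogonal:
  assumes "triad E r S" "triangle E r {a, b, c}" "a \<in> S" shows "b \<in> S \<or> c \<in> S"
proof (rule ccontr)
  assume "\<not> ?thesis"
  then have bc: "b \<in> E - S" "c \<in> E - S" "b \<noteq> c" and a: "a \<in> E"
    using assms unfolding triangle_def card3_distinct by auto
  have "r (insert a (E - S)) + r {b, c} \<le> r (E - S) + r {a, b, c}"
    using bc by (intro r_sub) auto
  then have 1: "r (insert a (E - S)) \<le> r (E - S)"
    using assms(2) pair_rank[of b c] bc unfolding triangle_def by auto
  have "card (S - {a}) = 2" using assms unfolding triad_def by (simp add: card_Diff_singleton)
  then obtain u w where uw: "S - {a} = {u, w}" "u \<noteq> w" by (auto simp: card_2_iff)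
  then have "insert a (E - S) = E - {u, w}" using assms(3) a by auto
  moreover have "u \<in> E" "w \<in> E" using uw assms(1) unfolding triad_def by auto
  ultimately show False using 1 pair_rank[of u w] uw(2) assms(1) unfolding triad_def by simp
qed

text \<open>After deletion of \<open>e\<close> the elements \<open>a\<close> and \<open>b\<close>
  are in series. If \<open>b\<close> is contracted, \<open>a\<close> may be contracted instead. If
  neither is, \<open>b\<close> cannot belong to \<open>N\<close>, since it would be a coloop there;
  then \<open>a\<close> is a coloop of what remains and contracting it changes nothing. Only
  \<open>e\<close> and \<open>a\<close> are required to avoid \<open>V\<close>, so \<open>b\<close>
  may lie in \<open>F\<close>.\<close>

lemma triad_series:
  assumes "triad E r {e, a, b}" "e \<notin> V" "a \<notin> V" "del_keeps E r V \<rho> e"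
  shows "con_keeps E r V \<rho> a"
proof -
  obtain C where rep: "minor_rep E r V \<rho> C" and eC: "e \<notin> C"
    using assms(4) unfolding del_keeps_def by auto
  have C: "C \<subseteq> E - V" and rho: "\<And>X. X \<subseteq> V \<Longrightarrow> r (X \<union> C) - r C = \<rho> X"
    using rep unfolding minor_rep_def by auto
  have t: "a \<in> E" "b \<in> E" "e \<in> E" "a \<noteq> b" "a \<noteq> e" "b \<noteq> e" "r (E - {e, a, b}) + 1 \<le> r E"
    using assms(1) unfolding triad_def card3_distinct by auto
  \<comment> \<open>Adding \<open>a\<close> or \<open>b\<close> to \<open>E - {e, a, b}\<close>
    restores full rank by cosimplicity, hence raises the rank by one; submodularity passes this down
    to every subset \<open>X\<close>.\<close>
  have up: "r (insert c X) = r X + 1" if "X \<subseteq> E - {e, a, b}" "c = a \<or> c = b" for X c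
  proof -
    have "r (E - {e, a, b} \<union> {c}) + r X \<le> r (insert c X) + r (E - {e, a, b})"
      using that by (intro r_sub) auto
    moreover have "r E \<le> r (E - {e, a, b} \<union> {c})" using that(2)
    proof
      assume "c = a"
      then have "r (E - {e, b}) \<le> r (E - {e, a, b} \<union> {c})" by (intro r_mono) auto
      then show ?thesis using pair_rank(2)[of e b] t by simp
    next
      assume "c = b"
      then have "r (E - {e, a}) \<le> r (E - {e, a, b} \<union> {c})" by (intro r_mono) auto
      then show ?thesis using pair_rank(2)[of e a] t by simp
    qed
    ultimately show ?thesis using t(7) r_insert[of c X] by linarith
  qed
  show ?thesis
  proof (cases "a \<in> C")
    case True
    then show ?thesis using rep unfolding con_keeps_def by auto
  next
    case aC: False
    show ?thesis
    proof (cases "b \<in> C")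
      case True
      let ?C = "insert a (C - {b})"
      have eq: "r (X \<union> ?C) = r (X \<union> C)" if "X \<subseteq> V" for X
      proof -
        have "X \<union> (C - {b}) \<subseteq> E - {e, a, b}"
          using that C aC eC True assms(2,3) V_E by auto
        moreover have "insert a (X \<union> (C - {b})) = X \<union> ?C" "insert b (X \<union> (C - {b})) = X \<union> C"
          using True by auto
        ultimately show ?thesis using up[of "X \<union> (C - {b})" a] up[of "X \<union> (C - {b})" b] by simp
      qed
      then have "minor_rep E r V \<rho> ?C"
        using rho C t assms(3) eq[of "{}"] unfolding minor_rep_def by auto
      then show ?thesis unfolding con_keeps_def by auto
    next
      case bC: False
      have "b \<notin> V"
      proof
        assume bV: "b \<in> V"
        have "V - {b} \<union> C \<subseteq> E - {e, a, b}" using C V_E aC bC eC assms(2,3) by auto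
        moreover have "insert b (V - {b} \<union> C) = V \<union> C" using bV by auto
        ultimately have "r (V \<union> C) = r (V - {b} \<union> C) + 1" using up by metis
        then show False using rho[of V] rho[of "V - {b}"] no_coloop[OF bV] by auto
      qed
      then have eq: "r (X \<union> insert a C) = r (X \<union> C) + 1" if "X \<subseteq> V" for X
        using up[of "X \<union> C" a] that C V_E aC bC eC assms(2,3) by auto
      then have "minor_rep E r V \<rho> (insert a C)"
        using rho C t assms(3) eq[of "{}"] unfolding minor_rep_def by auto
      then show ?thesis unfolding con_keeps_def by auto
    qed
  qed
qed

lemma triangle_parallel:
  assumes "triangle E r {e, a, b}" "e \<notin> V" "a \<notin> V" "con_keeps E r V \<rho> e"
  shows "del_keeps E r V \<rho> a"
proof -
  interpret D: stuck_minor E "dual_rank E r" T F V "dual_rank V \<rho>" by (rule stuck_dual)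
  have "e \<in> E - V" "a \<in> E - V" using assms unfolding triangle_def by auto
  then show ?thesis
    using D.triad_series[of e a b] assms by (simp add: triad_dual keeps_dual)
qed

section \<open>Bixby's lemma and Tutte's triangle lemma\<close>

text \<open>A 2-separation of the deletion is crossed with one of the contraction. Without triads
  and triangles through \<open>g\<close> all four sides have at least three elements, while
  uncrossing makes one quadrant on each diagonal have at most one. Two such quadrants share a side,
  which then has at most two elements.\<close>

lemma bixby:
  assumes "g \<in> E" "\<not> del_3conn E r g" "\<not> con_3conn E r g"
  shows "(\<exists>S. triad E r S \<and> g \<in> S) \<or> (\<exists>S. triangle E r S \<and> g \<in> S)"
proof (rule ccontr)
  assume no: "\<not> ?thesis"
  obtain P where P: "P \<subseteq> E - {g}" "2 \<le> card P" "2 \<le> card (E - {g} - P)"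
    "r P + r (E - {g} - P) \<le> r E + 1" using not_del_obtain[OF assms(1,2)] .
  obtain P' where P': "P' \<subseteq> E - {g}" "2 \<le> card P'" "2 \<le> card (E - {g} - P')"
    "r (insert g P') + r (E - P') \<le> r E + 2" using not_con_obtain[OF assms(1,3)] .
  let ?Q = "E - {g} - P" and ?Q' = "E - {g} - P'"
  have big: "3 \<le> card X" if X: "X \<subseteq> E - {g}" "2 \<le> card X" "r X + r (E - {g} - X) \<le> r E + 1" for X
  proof (rule ccontr)
    assume "\<not> 3 \<le> card X"
    then have "card X = 2" using X by simp
    then obtain u w where uw: "X = {u, w}" "u \<noteq> w" by (auto simp: card_2_iff)
    have "E - {g} - X = E - {g, u, w}" using uw by auto
    then have "triad E r {g, u, w}"
      using X uw assms(1) pair_rank[of u w] unfolding triad_def card3_distinct by auto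
    then show False using no by blast
  qed
  have big': "3 \<le> card X" if X: "X \<subseteq> E - {g}" "2 \<le> card X" "r (insert g X) + r (E - X) \<le> r E + 2" for X
  proof (rule ccontr)
    assume "\<not> 3 \<le> card X"
    then have "card X = 2" using X by simp
    then obtain u w where uw: "X = {u, w}" "u \<noteq> w" by (auto simp: card_2_iff)
    then have "triangle E r {g, u, w}"
      using X uw assms(1) pair_rank[of u w] unfolding triangle_def card3_distinct by auto
    then show False using no by blast
  qed
  have eqs: "E - {g} - ?Q = P" "E - ?Q' = insert g P'" "insert g ?Q' = E - P'"
    using P(1) P'(1) assms(1) by auto
  have c: "3 \<le> card P" "3 \<le> card ?Q" "3 \<le> card P'" "3 \<le> card ?Q'"
    using big[of P] big[of ?Q] big'[of P'] big'[of ?Q'] P P' unfolding eqs by (auto simp: add.commute)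
  have fP: "finite P" "finite ?Q" "finite P'" "finite ?Q'"
    using P(1) P'(1) fin finite_subset[of _ "E - {g}"] by auto
  have split1: "card X = card (X \<inter> P') + card (X \<inter> ?Q')" if "X \<subseteq> E - {g}" for X
  proof -
    have "finite X" "X - P' = X \<inter> ?Q'" using that fin finite_subset[of X "E - {g}"] by auto
    then show ?thesis using card_Int_Diff[of X P'] by simp
  qed
  have split2: "card X = card (P \<inter> X) + card (?Q \<inter> X)" if "X \<subseteq> E - {g}" for X
  proof -
    have "finite X" "X - P = ?Q \<inter> X" using that fin finite_subset[of X "E - {g}"] by auto
    then show ?thesis using card_Int_Diff[of X P] by (simp add: Int_commute)
  qed
  \<comment> \<open>Opposite quadrants have connectivities adding up to at most 3: the two
    separations contribute \<open>r E + 1\<close> and \<open>r E + 2\<close>. So they cannot both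
    reach 2.\<close>
  have cross: "card (X \<inter> X') \<le> 1 \<or> card (Y \<inter> Y') \<le> 1"
    if X: "X \<subseteq> E - {g}" "Y = E - {g} - X" "r X + r Y \<le> r E + 1" "3 \<le> card X"  "3 \<le> card Y"
      and X': "X' \<subseteq> E - {g}" "Y' = E - {g} - X'" "r (insert g X') + r (insert g Y') \<le> r E + 2"
    for X Y X' Y'
  proof (rule ccontr)
    assume n: "\<not> ?thesis"
    have "r (E - (Y \<inter> Y')) + r (X \<inter> X') \<le> r X + r (insert g X')"
      using X X' by (intro r_sub) auto
    moreover have "r (E - (X \<inter> X')) + r (Y \<inter> Y') \<le> r Y + r (insert g Y')"
      using X X' by (intro r_sub) auto
    ultimately have "connf E r (X \<inter> X') + connf E r (Y \<inter> Y') \<le> 3"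
      using X(3) X'(3) unfolding connf_def by linarith
    moreover have "card Y \<le> card (E - (X \<inter> X'))" "card X \<le> card (E - (Y \<inter> Y'))"
      using X fin by (auto intro!: card_mono)
    moreover have "X \<inter> X' \<subseteq> E" "Y \<inter> Y' \<subseteq> E" using X by auto
    ultimately show False using conn3[of "X \<inter> X'"] conn3[of "Y \<inter> Y'"] n X(4,5) by linarith
  qed
  have P4: "r (insert g P') + r (insert g ?Q') \<le> r E + 2" using P'(4) unfolding eqs .
  have "card (P \<inter> P') \<le> 1 \<or> card (?Q \<inter> ?Q') \<le> 1"
    using P P' P4 c by (intro cross) auto
  moreover have "card (P \<inter> ?Q') \<le> 1 \<or> card (?Q \<inter> P') \<le> 1"
    using P P' P4 c by (intro cross) auto
  ultimately show False
    using split1[of P] split1[of ?Q] split2[of P'] split2[of ?Q'] P(1) P'(1) c by auto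
qed

text \<open>The 2-separation left by deleting \<open>a\<close> must split \<open>b\<close> from
  \<open>c\<close>, and the one left by deleting \<open>b\<close> must split \<open>a\<close> from
  \<open>c\<close>. Crossing them isolates a single element \<open>u\<close>, which forms a triad
  with \<open>a\<close> and \<open>b\<close>.\<close>

lemma tutte_triangle:
  assumes "triangle E r {a, b, c}" "\<not> del_3conn E r a" "\<not> del_3conn E r b"
  shows "\<exists>z. z \<notin> {a, b, c} \<and> (triad E r {a, b, z} \<or> triad E r {a, c, z})"
proof (rule ccontr)
  assume no: "\<not> ?thesis"
  have t: "a \<in> E" "b \<in> E" "c \<in> E" "a \<noteq> b" "a \<noteq> c" "b \<noteq> c" "r {a, b, c} \<le> 2"
    using assms(1) unfolding triangle_def card3_distinct by auto
  have span: "r (X \<union> {a, b, c}) \<le> r X"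
    if "u \<in> X" "v \<in> X" "u \<noteq> v" "u \<in> {a, b, c}" "v \<in> {a, b, c}" for u v X
  proof -
    have "r (X \<union> {a, b, c}) + r {u, v} \<le> r X + r {a, b, c}" using that by (intro r_sub) auto
    then show ?thesis using pair_rank[of u v] that t by auto
  qed
  \<comment> \<open>If both remaining triangle elements lay on one side, that side would span
    \<open>g\<close>, and returning \<open>g\<close> to it would give a set of connectivity at most
    1 in a 3-connected matroid.\<close>
  have sep: "\<exists>X Y. X \<union> Y = E - {g} \<and> X \<inter> Y = {} \<and> h \<in> X \<and> k \<in> Y \<and> 2 \<le> card X \<and> 2 \<le> card Y
      \<and> r X + r Y \<le> r E + 1"
    if g: "{g, h, k} = {a, b, c}" "g \<noteq> h" "g \<noteq> k" "h \<noteq> k" "\<not> del_3conn E r g" for g h k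
  proof -
    have gE: "g \<in> E" "h \<in> E" "k \<in> E" using g t by auto
    obtain X where X: "X \<subseteq> E - {g}" "2 \<le> card X" "2 \<le> card (E - {g} - X)"
      "r X + r (E - {g} - X) \<le> r E + 1" using not_del_obtain[OF gE(1) g(5)] .
    have ns: "\<not> (h \<in> X \<and> k \<in> X)" if X: "X \<subseteq> E - {g}" "2 \<le> card X" "2 \<le> card (E - {g} - X)"
      "r X + r (E - {g} - X) \<le> r E + 1" for X
    proof
      assume hk: "h \<in> X \<and> k \<in> X"
      have "r (X \<union> {a, b, c}) \<le> r X" using hk g by (intro span[of h X k]) auto
      moreover have "r (insert g X) \<le> r (X \<union> {a, b, c})" using g by (intro r_mono) auto
      moreover have "E - insert g X = E - {g} - X" by auto
      ultimately have "connf E r (insert g X) \<le> 1" using X(4) unfolding connf_def by simp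
      moreover have "insert g X \<subseteq> E" "2 \<le> card (insert g X)"
        using X gE card_insert_le[of X g] by (auto intro: le_trans)
      ultimately show False
        using conn3[of "insert g X"] X(3) \<open>E - insert g X = E - {g} - X\<close> by simp
    qed
    have eq: "E - {g} - (E - {g} - X) = X" using X by auto
    show ?thesis
    proof (cases "h \<in> X")
      case True
      then show ?thesis using ns[OF X] X gE g
        by (intro exI[of _ X] exI[of _ "E - {g} - X"]) auto
    next
      case False
      then have "k \<in> X" using ns[of "E - {g} - X"] X gE g by (auto simp: eq add.commute)
      then show ?thesis using False X gE g
        by (intro exI[of _ "E - {g} - X"] exI[of _ X]) (auto simp: add.commute)
    qed
  qed
  obtain X Y where XY: "X \<union> Y = E - {a}" "X \<inter> Y = {}" "b \<in> X" "c \<in> Y" "2 \<le> card X" "2 \<le> card Y"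
    "r X + r Y \<le> r E + 1" using sep[of a b c] t assms(2) by auto
  obtain P Q where PQ: "P \<union> Q = E - {b}" "P \<inter> Q = {}" "a \<in> P" "c \<in> Q" "2 \<le> card P" "2 \<le> card Q"
    "r P + r Q \<le> r E + 1" using sep[of b a c] t assms(3) by (auto simp: insert_commute)
  have fXY: "finite X" "finite Y" "finite P" "finite Q"
    using XY(1) PQ(1) fin by (metis finite_Diff finite_Un)+
  have tri: "\<exists>z. X = {u, z} \<and> triad E r {g, u, z}"
    if H: "X \<union> Y = E - {g}" "X \<inter> Y = {}" "r X + r Y \<le> r E + 1" "u \<in> X" "card X = 2" "g \<in> E" for X Y g u
  proof -
    obtain z where z: "X = {u, z}" "u \<noteq> z" using H(4,5) by (auto simp: card_2_iff)
    have "Y = E - {g, u, z}" using H(1,2) z by auto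
    moreover have "u \<in> E" "z \<in> E" "u \<noteq> g" "z \<noteq> g" using H(1) z by auto
    ultimately have "triad E r {g, u, z}"
      using H(3,6) z pair_rank[of u z] unfolding triad_def card3_distinct by auto
    then show ?thesis using z by auto
  qed
  \<comment> \<open>A two-element side closes up to a triad with the deleted element. No such claim
    is made for \<open>Q\<close>: it would produce a triad on \<open>b\<close> and \<open>c\<close>,
    which the conclusion does not offer.\<close>
  have X3: "card X \<noteq> 2"
  proof
    assume "card X = 2"
    then obtain z where "X = {b, z}" "triad E r {a, b, z}" using tri[of X Y a b] XY t by auto
    moreover have "z \<notin> {a, b, c}"
      using calculation XY by (auto simp: triad_def card3_distinct)
    ultimately show False using no by blast
  qed
  have Y3: "card Y \<noteq> 2"
  proof
    assume "card Y = 2"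
    then obtain z where "Y = {c, z}" "triad E r {a, c, z}"
      using tri[of Y X a c] XY t by (auto simp: Un_commute Int_commute add.commute)
    moreover have "z \<notin> {a, b, c}"
      using calculation XY by (auto simp: triad_def card3_distinct)
    ultimately show False using no by blast
  qed
  have P3: "card P \<noteq> 2"
  proof
    assume "card P = 2"
    then obtain z where "P = {a, z}" "triad E r {b, a, z}" using tri[of P Q b a] PQ t by auto
    moreover have "z \<notin> {a, b, c}"
      using calculation PQ by (auto simp: triad_def card3_distinct)
    moreover have "{a, b, z} = {b, a, z}" by auto
    ultimately show False using no by metis
  qed
  have cX: "card X = Suc (card (X \<inter> P) + card (X \<inter> Q))"
  proof -
    have "X = insert b ((X \<inter> P) \<union> (X \<inter> Q))" using XY PQ by auto
    moreover have "card ((X \<inter> P) \<union> (X \<inter> Q)) = card (X \<inter> P) + card (X \<inter> Q)"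
      using fXY PQ(2) by (intro card_Un_disjoint) auto
    moreover have "b \<notin> (X \<inter> P) \<union> (X \<inter> Q)" using PQ(1) by auto
    ultimately show ?thesis using fXY by (metis card_insert_disjoint finite_Int finite_Un)
  qed
  have cP: "card P = Suc (card (X \<inter> P) + card (Y \<inter> P))"
  proof -
    have "P = insert a ((X \<inter> P) \<union> (Y \<inter> P))" using XY PQ by auto
    moreover have "card ((X \<inter> P) \<union> (Y \<inter> P)) = card (X \<inter> P) + card (Y \<inter> P)"
      using fXY XY(2) by (intro card_Un_disjoint) auto
    moreover have "a \<notin> (X \<inter> P) \<union> (Y \<inter> P)" using XY(1) by auto
    ultimately show ?thesis using fXY by (metis card_insert_disjoint finite_Int finite_Un)
  qed
  have cY: "card Y = card (Y \<inter> P) + card (Y \<inter> Q)"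
  proof -
    have "Y = (Y \<inter> P) \<union> (Y \<inter> Q)" using XY PQ by auto
    moreover have "card ((Y \<inter> P) \<union> (Y \<inter> Q)) = card (Y \<inter> P) + card (Y \<inter> Q)"
      using fXY PQ(2) by (intro card_Un_disjoint) auto
    ultimately show ?thesis by metis
  qed
  have cQ: "card Q = card (X \<inter> Q) + card (Y \<inter> Q)"
  proof -
    have "Q = (X \<inter> Q) \<union> (Y \<inter> Q)" using XY PQ by auto
    moreover have "card ((X \<inter> Q) \<union> (Y \<inter> Q)) = card (X \<inter> Q) + card (Y \<inter> Q)"
      using fXY XY(2) by (intro card_Un_disjoint) auto
    ultimately show ?thesis by metis
  qed
  have big: "2 \<le> connf E r Z" if "Z \<subseteq> E" "2 \<le> card Z" "W \<subseteq> E - Z" "2 \<le> card W" for Z W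
    using that conn3[of Z] card_mono[of "E - Z" W] fin by simp
  have pos: "1 \<le> connf E r {z}" if "z \<in> E" for z
    using single_rank[OF that] unfolding connf_def by simp
  \<comment> \<open>On this diagonal the unions \<open>X \<union> Q\<close> and
    \<open>Y \<union> P\<close> each contain two elements of the triangle, so they span the third
    and uncrossing is exact.\<close>
  have uncross1: "connf E r (X \<inter> Q) + connf E r (Y \<inter> P) \<le> 2"
  proof -
    have "r (X \<union> Q \<union> {a, b, c}) \<le> r (X \<union> Q)" using XY PQ t by (intro span[of b _ c]) auto
    moreover have "r (E - (Y \<inter> P)) \<le> r (X \<union> Q \<union> {a, b, c})" using XY PQ by (intro r_mono) auto
    moreover have "r (Y \<union> P \<union> {a, b, c}) \<le> r (Y \<union> P)" using XY PQ t by (intro span[of a _ c]) auto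
    moreover have "r (E - (X \<inter> Q)) \<le> r (Y \<union> P \<union> {a, b, c})" using XY PQ by (intro r_mono) auto
    ultimately show ?thesis
      using r_submod[of X Q] r_submod[of Y P] XY(7) PQ(7) unfolding connf_def by linarith
  qed
  \<comment> \<open>Of the triangle, \<open>Y \<union> Q\<close> contains only \<open>c\<close>. Its
    rank is therefore kept as it stands; \<open>YQ\<close> records that completing it to the
    complement of \<open>X \<inter> P\<close> costs at most 1, for \<open>a\<close>, after which
    \<open>b\<close> is spanned.\<close>
  have uncross2: "r (X \<inter> P) + r (Y \<union> Q) + connf E r (Y \<inter> Q) \<le> r E + 2"
  proof -
    have "r (X \<union> P \<union> {a, b, c}) \<le> r (X \<union> P)" using XY PQ t by (intro span[of a _ b]) auto
    moreover have "r (E - (Y \<inter> Q)) \<le> r (X \<union> P \<union> {a, b, c})" using XY PQ by (intro r_mono) auto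
    ultimately show ?thesis
      using r_submod[of X P] r_submod[of Y Q] XY(7) PQ(7) unfolding connf_def by linarith
  qed
  have YQ: "connf E r (X \<inter> P) \<le> r (X \<inter> P) + r (Y \<union> Q) + 1 - r E"
  proof -
    have "r (insert a (Y \<union> Q) \<union> {a, b, c}) \<le> r (insert a (Y \<union> Q))"
      using XY PQ t by (intro span[of a _ c]) auto
    moreover have "r (E - (X \<inter> P)) \<le> r (insert a (Y \<union> Q) \<union> {a, b, c})"
      using XY PQ by (intro r_mono) auto
    ultimately show ?thesis using r_insert[of a "Y \<union> Q"] unfolding connf_def by linarith
  qed
  have sub: "X \<inter> Q \<subseteq> E" "Y \<inter> P \<subseteq> E" "X \<inter> P \<subseteq> E" "Y \<inter> Q \<subseteq> E" using XY(1) by auto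
  show False
  proof (cases "2 \<le> card (X \<inter> Q)")
    case True
    have "2 \<le> connf E r (X \<inter> Q)"
      using True sub XY by (intro big[of _ Y]) auto
    then have "connf E r (Y \<inter> P) \<le> 0" using uncross1 by simp
    moreover have "card (Y \<inter> P) \<le> 1"
    proof (rule ccontr)
      assume "\<not> ?thesis"
      then have "2 \<le> connf E r (Y \<inter> P)" using sub XY by (intro big[of _ X]) auto
      then show False using calculation by simp
    qed
    ultimately have e: "Y \<inter> P = {}"
      using pos sub(2) by (metis card_0_eq card_1_singletonE fXY(2) finite_Int insert_subset
          le_less_linear less_one linorder_not_le nle_le not_one_le_zero order_trans zero_less_one_class.zero_le_one)
    then have "card (Y \<inter> Q) \<ge> 2" using cY XY(6) by simp
    then have "2 \<le> connf E r (Y \<inter> Q)" using sub XY by (intro big[of _ X]) auto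
    then have "connf E r (X \<inter> P) \<le> 1" using uncross2 YQ by simp
    moreover have "card (X \<inter> P) \<le> 1"
    proof (rule ccontr)
      assume "\<not> ?thesis"
      then have "2 \<le> connf E r (X \<inter> P)" using sub XY by (intro big[of _ Y]) auto
      then show False using calculation by simp
    qed
    ultimately show False using cP e P3 PQ(5) by simp
  next
    case XQ: False
    show False
    proof (cases "2 \<le> card (Y \<inter> P)")
      case True
      have "2 \<le> connf E r (Y \<inter> P)" using True sub XY by (intro big[of _ X]) auto
      then have "connf E r (X \<inter> Q) \<le> 0" using uncross1 by simp
      then have e: "card (X \<inter> Q) = 0"
        using pos sub(1) XQ
        by (metis One_nat_def Suc_1 card_1_singletonE insert_subset less_Suc_eq less_one
            not_less not_one_le_zero order_trans zero_less_one_class.zero_le_one)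
      have "2 \<le> card (X \<inter> P)" using cX e X3 XY(5) by simp
      then have "2 \<le> connf E r (X \<inter> P)" using sub XY by (intro big[of _ Y]) auto
      then have "connf E r (Y \<inter> Q) \<le> 1" using uncross2 YQ by simp
      moreover have "2 \<le> card (Y \<inter> Q)" using cQ e PQ(6) by simp
      then have "2 \<le> connf E r (Y \<inter> Q)" using sub XY by (intro big[of _ X]) auto
      ultimately show False by simp
    next
      case YP: False
      have YQ2: "2 \<le> card (Y \<inter> Q)" using cY YP Y3 XY(6) by simp
      then have c2: "2 \<le> connf E r (Y \<inter> Q)" using sub XY by (intro big[of _ X]) auto
      then have "connf E r (X \<inter> P) \<le> 1" using uncross2 YQ by simp
      moreover have "2 \<le> connf E r (X \<inter> P)" if "2 \<le> card (X \<inter> P)"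
        using that sub XY by (intro big[of _ Y]) auto
      ultimately have "card (X \<inter> P) \<le> 1" by linarith
      moreover have "1 \<le> card (X \<inter> P)" using cX XQ X3 XY(5) by simp
      ultimately have "card (X \<inter> P) = 1" by simp
      then obtain u where u: "X \<inter> P = {u}" by (auto simp: card_1_singleton_iff)
      have uE: "u \<in> E" "u \<noteq> a" "u \<noteq> b" "u \<noteq> c" using u XY PQ by auto
      \<comment> \<open>\<open>r {u} = 1\<close> and connectivity at least 2 of
        \<open>Y \<inter> Q\<close> use up three units of the bound \<open>r E + 2\<close>, so the
        complement \<open>Y \<union> Q\<close> of \<open>{a, b, u}\<close> is not spanning.\<close>
      have "r (Y \<union> Q) + 1 \<le> r E"
        using uncross2 c2 u single_rank[OF uE(1)] by simp
      moreover have "E - {a, b, u} = Y \<union> Q" using XY PQ u by auto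
      ultimately have "triad E r {a, b, u}"
        using uE t unfolding triad_def card3_distinct by auto
      then show False using no uE by blast
    qed
  qed
qed

section \<open>Flexible elements inside a minimal 2-separation\<close>

lemma separation_both_keep:
  assumes e: "e \<in> E - F" "del_keeps E r V \<rho> e" and no_triad: "\<And>S. triad E r S \<Longrightarrow> e \<notin> S"
  shows "\<exists>g \<in> E - F. del_keeps E r V \<rho> g \<and> con_keeps E r V \<rho> g"
proof -
  define Pr where "Pr A \<longleftrightarrow> A \<in> T \<and> e \<notin> A \<and> 2 \<le> card A \<and> r A + r (E - {e} - A) \<le> r E + 1" for A
  have eE: "e \<in> E" using e by auto
  obtain A0 where "Pr A0"
    using small_two_separation[OF eE stuck_del[OF e]] unfolding Pr_def by metis
  then obtain A where PrA: "Pr A" and min: "\<And>X. Pr X \<Longrightarrow> card A \<le> card X"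
    using ex_has_least_nat[of Pr A0 card] by blast
  define B where "B = E - {e} - A"
  have A: "A \<in> T" "e \<notin> A" "2 \<le> card A" "r A + r B \<le> r E + 1"
    using PrA unfolding Pr_def B_def by auto
  have AE: "A \<subseteq> E" using A(1) T_sub by auto
  have fA: "finite A" using AE fin finite_subset by blast
  have AB: "A \<inter> B = {}" "A \<union> B = E - {e}" using AE A(2) unfolding B_def by auto
  have rAB: "r (A \<union> B) = r E" using AB single_rank[OF eE] by simp
  \<comment> \<open>Restoring \<open>e\<close> to \<open>A\<close> gives a small 3-separating set.
    With two elements in \<open>F\<close> it would lie inside \<open>F\<close>, but \<open>e\<close>
    does not.\<close>
  have small_F: "card (A \<inter> F) \<le> 1"
  proof (rule ccontr)
    assume "\<not> ?thesis"
    moreover have "insert e A \<inter> F = A \<inter> F" using e by auto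
    ultimately have 2: "2 \<le> card (insert e A \<inter> F)" by simp
    have "E - insert e A = B" unfolding B_def by auto
    then have "connf E r (insert e A) \<le> 2"
      using r_insert[of e A] A(4) unfolding connf_def by simp
    then have "insert e A \<subseteq> F" using F_line[OF T_insert[OF A(1) eE] _ 2] by simp
    then show False using e by auto
  qed
  have A3: "3 \<le> card A"
  proof (rule ccontr)
    assume "\<not> 3 \<le> card A"
    then have "card A = 2" using A by simp
    then obtain u w where uw: "A = {u, w}" "u \<noteq> w" by (auto simp: card_2_iff)
    have "B = E - {e, u, w}" using uw unfolding B_def by auto
    then have "triad E r {e, u, w}"
      using A AE uw eE pair_rank[of u w] unfolding triad_def card3_distinct by auto
    then show False using no_triad by blast
  qed
  have exact: "r A + r B = r E + 1"
  proof -
    have "2 \<le> connf E r A" using conn3[OF AE A(3) T_compl_big[OF A(1)]] .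
    moreover have "r (E - A) \<le> r B + 1" unfolding B_def by (rule r_remove[of _ e]) auto
    ultimately show ?thesis using A(4) unfolding connf_def by linarith
  qed
  \<comment> \<open>Minimality of \<open>A\<close> in use: a smaller 2-separating subset would be
    small as well, since \<open>T\<close> passes to subsets of connectivity at most 2.\<close>
  have proper: "r E + 2 \<le> r X + r (E - {e} - X)" if X: "X \<subset> A" "2 \<le> card X" for X
  proof (rule ccontr)
    assume n: "\<not> ?thesis"
    have "r (E - X) \<le> r (E - {e} - X) + 1" by (rule r_remove[of _ e]) auto
    then have "connf E r X \<le> 2" using n unfolding connf_def by linarith
    then have "X \<in> T" using T_subset[of X A] X A by auto
    then have "Pr X" using n X A unfolding Pr_def by auto
    then show False using min[of X] psubset_card_mono[OF fA X(1)] by simp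
  qed
  \<comment> \<open>\<open>M \ e\<close> is a 2-sum of two parts on \<open>A\<close> and \<open>B\<close> along a basepoint \<open>p\<close>; \<open>f P = 1\<close> says that
    \<open>P \<subseteq> A\<close> spans \<open>p\<close>, and \<open>h Q = 1\<close> that \<open>Q \<subseteq> B\<close> spans \<open>p\<close>.\<close>
  define f where "f P = r P + r B - r (P \<union> B)" for P
  define h where "h Q = r A + r Q - r (A \<union> Q)" for Q
  have f0: "0 \<le> f P" if "P \<subseteq> A" for P
    using r_sub[of "P \<union> B" P B "{}"] r_empty unfolding f_def by auto
  have f1: "f P \<le> 1" if "P \<subseteq> A" for P
  proof -
    have "r (A \<union> B) + r P \<le> r A + r (P \<union> B)" using that by (intro r_sub) auto
    then show ?thesis using exact rAB unfolding f_def by linarith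
  qed
  have f_mono: "f P \<le> f P'" if "P \<subseteq> P'" "P' \<subseteq> A" for P P'
  proof -
    have "r (P' \<union> B) + r P \<le> r P' + r (P \<union> B)" using that by (intro r_sub) auto
    then show ?thesis unfolding f_def by linarith
  qed
  have rank2: "r (P \<union> Q) = r P + r Q - (if f P = 1 \<and> h Q = 1 then 1 else 0)"
    if PQ: "P \<subseteq> A" "Q \<subseteq> B" for P Q
  proof -
    have "r (P \<union> Q) + r {} \<le> r P + r Q" by (rule r_sub) auto
    moreover have "r (P \<union> B) + r Q \<le> r (P \<union> Q) + r B" using PQ by (intro r_sub) auto
    moreover have "r (A \<union> Q) + r P \<le> r (P \<union> Q) + r A" using PQ by (intro r_sub) auto
    moreover have "r (A \<union> B) + r (P \<union> Q) \<le> r (P \<union> B) + r (A \<union> Q)"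
      using PQ by (intro r_sub) auto
    moreover have "h Q \<le> 1"
    proof -
      have "r (A \<union> B) + r Q \<le> r (A \<union> Q) + r B" using PQ by (intro r_sub) auto
      then show ?thesis using exact rAB unfolding h_def by linarith
    qed
    ultimately show ?thesis
      using f1[OF PQ(1)] f0[OF PQ(1)] r_empty exact rAB unfolding f_def h_def by auto
  qed
  obtain C where rep: "minor_rep E r V \<rho> C" and eC: "e \<notin> C"
    using e(2) unfolding del_keeps_def by auto
  have C: "C \<subseteq> E - V" and rho_C: "\<And>X. X \<subseteq> V \<Longrightarrow> r (X \<union> C) - r C = \<rho> X"
    using rep unfolding minor_rep_def by auto
  define CA where "CA = C \<inter> A"
  define CB where "CB = C \<inter> B"
  have CAB: "C = CA \<union> CB" "CA \<subseteq> A" "CB \<subseteq> B" "CB \<subseteq> E - V" "CA \<inter> V = {}"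
    using C eC AB unfolding CA_def CB_def by blast+
  have VAB: "V \<subseteq> A \<union> B" using V_E VF e AB by auto
  show ?thesis
  proof (cases "V \<inter> A = {}")
    case True
    \<comment> \<open>When \<open>N\<close> avoids \<open>A\<close>, the \<open>A\<close>-part of
      the contracted set matters only through whether it spans the basepoint, so any
      \<open>D\<close> with the same \<open>f\<close> may replace \<open>CA\<close>.\<close>
    have new: "minor_rep E r V \<rho> (D \<union> CB)" if D: "D \<subseteq> A" "f D = f CA" for D
    proof -
      have "r (X \<union> (D \<union> CB)) - r (D \<union> CB) = \<rho> X" if X: "X \<subseteq> V" for X
      proof -
        have XB: "X \<union> CB \<subseteq> B" using X VAB True CAB by auto
        have "X \<union> (D \<union> CB) = D \<union> (X \<union> CB)" "X \<union> C = CA \<union> (X \<union> CB)" using CAB by auto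
        then show ?thesis
          using rank2[OF D(1) XB] rank2[OF CAB(2) XB] rank2[OF D(1) CAB(3)] rank2[OF CAB(2,3)]
            rho_C[OF X] CAB(1) D(2) by simp
      qed
      moreover have "D \<union> CB \<subseteq> E - V" using D True CAB AE by auto
      ultimately show ?thesis unfolding minor_rep_def by auto
    qed
    have "card A = card (A \<inter> F) + card (A - F)" using card_Int_Diff[OF fA] .
    then have "2 \<le> card (A - F)" using small_F A3 by simp
    then obtain g k where gk: "g \<in> A - F" "k \<in> A - F" "g \<noteq> k" by (rule two_le_card_obtain)
    have gkE: "g \<in> E" "k \<in> E" "g \<noteq> e" "k \<noteq> e" "g \<notin> CB" "k \<notin> CB"
      using gk AE A(2) AB CAB by auto
    have fCA: "f CA = 0 \<or> f CA = 1" using f0[OF CAB(2)] f1[OF CAB(2)] by auto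
    show ?thesis
    proof (rule ccontr)
      assume no: "\<not> ?thesis"
      from fCA show False
      proof
        \<comment> \<open>All of \<open>A\<close> may be contracted. If some \<open>u\<close> cannot
          be deleted, then \<open>A - {u}\<close> does not span the basepoint, so \<open>r\<close>
          drops by one. Two elements of this kind form a triad with \<open>e\<close>.\<close>
        assume 1: "f CA = 1"
        have fA1: "f A = 1" using exact rAB unfolding f_def by simp
        have down: "r (A - {u}) = r A - 1" if u: "u \<in> A - F" for u
        proof -
          have "u \<notin> CB" "u \<in> E" "u \<noteq> e" using u CAB AB A(2) AE by auto
          have "con_keeps E r V \<rho> u"
            using new[of A] fA1 1 u unfolding con_keeps_def by auto
          then have "\<not> del_keeps E r V \<rho> u" using no u AE by auto
          then have "f (A - {u}) \<noteq> 1"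
            using new[of "A - {u}"] 1 \<open>u \<notin> CB\<close> unfolding del_keeps_def by auto
          then have "f (A - {u}) = 0" using f0[of "A - {u}"] f1[of "A - {u}"] by auto
          moreover have "A - {u} \<union> B = E - {e, u}" using AB u by blast
          moreover have "r (E - {e, u}) = r E" using pair_rank[OF eE \<open>u \<in> E\<close>] \<open>u \<noteq> e\<close> by auto
          ultimately show ?thesis using exact unfolding f_def by simp
        qed
        have "r A + r (A - {g, k}) \<le> r (A - {g}) + r (A - {k})" using gk by (intro r_sub) auto
        then have "r (A - {g, k}) \<le> r A - 2" using down gk by simp
        moreover have "r (E - {e, g, k}) + r {} \<le> r (A - {g, k}) + r B"
          using AB by (intro r_sub) blast+
        ultimately have "r (E - {e, g, k}) + 1 \<le> r E" using exact r_empty by simp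
        then have "triad E r {e, g, k}"
          using gkE eE gk unfolding triad_def card3_distinct by auto
        then show False using no_triad by blast
      next
        \<comment> \<open>All of \<open>A\<close> may be deleted. If some \<open>u\<close> cannot be
          contracted, it is parallel to the basepoint, and two such elements would be parallel to
          each other.\<close>
        assume 0: "f CA = 0"
        have f00: "f {} = 0" using r_empty unfolding f_def by simp
        have up: "r (insert u B) = r B" if u: "u \<in> A - F" for u
        proof -
          have "u \<notin> CB" "u \<in> E" using u CAB AB AE by auto
          have "del_keeps E r V \<rho> u"
            using new[of "{}"] f00 0 \<open>u \<notin> CB\<close> unfolding del_keeps_def by auto
          then have "\<not> con_keeps E r V \<rho> u" using no u AE by auto
          then have "f {u} \<noteq> 0" using new[of "{u}"] 0 u unfolding con_keeps_def by auto
          then have "f {u} = 1" using f0[of "{u}"] f1[of "{u}"] u by auto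
          then show ?thesis using single_rank[OF \<open>u \<in> E\<close>] unfolding f_def by simp
        qed
        have "r ({g, k} \<union> B) + r B \<le> r (insert g B) + r (insert k B)" by (rule r_sub) auto
        then have "r ({g, k} \<union> B) \<le> r B" using up gk by simp
        moreover have "f {g, k} \<le> 1" using f1 gk by auto
        ultimately show False using pair_rank[of g k] gkE gk unfolding f_def by simp
      qed
    qed
  next
    case False
    then obtain x where x: "x \<in> V" "x \<in> A" by auto
    have only_x: "u = x" if "u \<in> A" "u \<in> F" for u
      using card_le_1[of "A \<inter> F" u x] small_F that x VF fA by auto
    have xE: "x \<in> E" using x AE by auto
    have VB: "V - {x} \<subseteq> B" using VAB only_x VF by auto
    have xB: "x \<notin> B" using x AB by auto
    have f_ins: "f (insert x D) = 0 \<or> f (insert x D) = 1" "f D = 0 \<or> f D = 1" if "D \<subseteq> A" for D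
      using f0[of "insert x D"] f1[of "insert x D"] f0[of D] f1[of D] that x by auto
    have diff: "\<rho> (insert x X) - \<rho> X = r (insert x CA) - r CA"
      if X: "X \<subseteq> V - {x}" and eq: "f (insert x CA) = f CA" for X
    proof -
      have XB: "X \<union> CB \<subseteq> B" using X VB CAB by auto
      have iA: "insert x CA \<subseteq> A" using x CAB by auto
      have sets: "insert x X \<union> C = insert x CA \<union> (X \<union> CB)" "X \<union> C = CA \<union> (X \<union> CB)" using CAB by auto
      have "insert x X \<subseteq> V" "X \<subseteq> V" using X x by auto
      then show ?thesis
        using rank2[OF iA XB] rank2[OF CAB(2) XB] eq rho_C[of "insert x X"] rho_C[of X]
        unfolding sets by simp
    qed
    have CAx: "f CA = 0" "f (insert x CA) = 1"
    proof -
      have "f (insert x CA) \<noteq> f CA"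
      proof
        \<comment> \<open>Then \<open>x\<close> adds the same amount to every
          \<open>\<rho> X\<close>: at least 1 for \<open>X = {}\<close>, as \<open>x\<close> is no
          loop, and at most 0 for \<open>X = V - {x}\<close>, as it is no coloop. Hence
          \<open>x\<close> must take over the role of the basepoint, which is what
          \<open>CAx\<close> states.\<close>
        assume eq: "f (insert x CA) = f CA"
        have "\<rho> {} = 0" using rank_fun.r_empty[OF rho] .
        moreover have "insert x (V - {x}) = V" using x by auto
        ultimately show False
          using diff[OF _ eq, of "{}"] diff[OF _ eq, of "V - {x}"] no_loop[OF x(1)] no_coloop[OF x(1)]
          by simp
      qed
      moreover have "f CA \<le> f (insert x CA)" by (rule f_mono) (use CAB(2) x in auto)
      ultimately show "f CA = 0" "f (insert x CA) = 1" using f_ins[OF CAB(2)] by auto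
    qed
    have val: "r (X \<union> (D \<union> CB)) - r (D \<union> CB) =
        (if x \<in> X then r (X - {x} \<union> CB) + 1 - (if h (X - {x} \<union> CB) = 1 then 1 else 0)
         else r (X \<union> CB)) - r CB"
      if D: "D \<subseteq> A - {x}" "f D = 0" "f (insert x D) = 1" and X: "X \<subseteq> V" for D X
    proof -
      have DA: "D \<subseteq> A" "insert x D \<subseteq> A" using D x by auto
      have "r (D \<union> B) \<le> r (insert x D \<union> B)" by (rule r_mono) auto
      then have xD: "r (insert x D) = r D + 1"
        using r_insert[of x D] D(2,3) unfolding f_def by linarith
      have base: "r (D \<union> CB) = r D + r CB" using rank2[OF DA(1) CAB(3)] D(2) by simp
      show ?thesis
      proof (cases "x \<in> X")
        case True
        have XB: "X - {x} \<union> CB \<subseteq> B" using X VB CAB by auto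
        have "X \<union> (D \<union> CB) = insert x D \<union> (X - {x} \<union> CB)" using True by auto
        then show ?thesis using rank2[OF DA(2) XB] D(3) True base xD by simp
      next
        case False
        have XB: "X \<union> CB \<subseteq> B" using X VB CAB False by auto
        have "X \<union> (D \<union> CB) = D \<union> (X \<union> CB)" by auto
        then show ?thesis using rank2[OF DA(1) XB] D(2) False base by simp
      qed
    qed
    have new: "minor_rep E r V \<rho> (D \<union> CB)" if D: "D \<subseteq> A - {x}" "f D = 0" "f (insert x D) = 1" for D
    proof -
      have CA: "CA \<subseteq> A - {x}" using CAB x by auto
      have "r (X \<union> (D \<union> CB)) - r (D \<union> CB) = \<rho> X" if X: "X \<subseteq> V" for X
        using val[OF D X] val[OF CA CAx X] rho_C[OF X] CAB(1) by simp
      moreover have "D \<union> CB \<subseteq> E - V"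
        using D CAB AE VB AB VF only_x by blast
      ultimately show ?thesis unfolding minor_rep_def by auto
    qed
    have "2 \<le> card (A - {x})" using A3 x fA by simp
    then obtain g where g: "g \<in> A" "g \<noteq> x" by (auto elim: two_le_card_obtain)
    have gE: "g \<in> E" "g \<noteq> e" "g \<notin> CB" using g AE A(2) AB CAB by auto
    have gF: "g \<notin> F" using only_x g by auto
    \<comment> \<open>Any contracted set inside \<open>A - {x}\<close> that makes \<open>x\<close>
      parallel to the basepoint represents \<open>N\<close>. The linking theorem between
      \<open>{x}\<close> and \<open>B\<close> supplies one that avoids \<open>g\<close> and one that
      contains \<open>g\<close>, the latter by starting from \<open>{g}\<close>. Its cut condition
      comes from \<open>proper\<close>.\<close>
    define S where "S = A - {x, g}"
    have fS: "finite S" using fA unfolding S_def by auto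
    have rf: "rank_fun E r" by (rule rank_fun_axioms)
    have fin_link: "f D = 0 \<and> f (insert x D) = 1"
      if D: "D \<subseteq> A" "1 + r ({x} \<union> B \<union> D) + r D \<le> r ({x} \<union> D) + r (B \<union> D)" for D
    proof -
      have "{x} \<union> B \<union> D = insert x D \<union> B" "{x} \<union> D = insert x D" "B \<union> D = D \<union> B" by auto
      then have "f D + 1 \<le> f (insert x D)" using D(2) unfolding f_def by simp
      then show ?thesis using f_ins[OF D(1)] by auto
    qed
    have "1 + r ({x} \<union> B \<union> S \<union> {}) + r {} \<le> r ({x} \<union> X \<union> {}) + r (B \<union> (S - X) \<union> {})"
      if X: "X \<subseteq> S" for X
    proof -
      have le: "r ({x} \<union> B \<union> S) \<le> r E" using AB AE xE unfolding S_def by (intro r_mono) auto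
      show ?thesis
      proof (cases "X = {}")
        case True
        \<comment> \<open>The empty cut needs \<open>{x, g}\<close> to be a proper subset of
          \<open>A\<close>; this is where \<open>card A \<ge> 3\<close> is used.\<close>
        have "card {x, g} = 2" using g by auto
        moreover have "A \<noteq> {x, g}" using calculation A3 by auto
        then have "{x, g} \<subset> A" using x g by auto
        ultimately have "r E + 2 \<le> r {x, g} + r (E - {e} - {x, g})" by (intro proper) auto
        moreover have "E - {e} - {x, g} = B \<union> S" using AB x g unfolding S_def by blast
        ultimately show ?thesis
          using True le pair_rank[OF xE gE(1)] single_rank[OF xE] g r_empty by auto
      next
        case False
        then obtain y where y: "y \<in> X" by auto
        have "2 \<le> card (insert x X)"
          using y X fS finite_subset[OF X fS] unfolding S_def by (intro two_le_card[of _ x y]) auto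
        moreover have "insert x X \<subset> A" using X x g unfolding S_def by auto
        ultimately have "r E + 2 \<le> r (insert x X) + r (E - {e} - insert x X)" by (intro proper) auto
        moreover have "r (E - {e} - insert x X) \<le> r (B \<union> (S - X)) + 1"
          using AB unfolding S_def by (intro r_remove[of _ g]) blast
        ultimately show ?thesis using le r_empty by simp
      qed
    qed
    then obtain Z where Z: "Z \<subseteq> S" "1 + r ({x} \<union> B \<union> Z) + r Z \<le> r ({x} \<union> Z) + r (B \<union> Z)"
      using linking[OF rf fS, of 1 "{x}" B "{}"] by auto
    have "minor_rep E r V \<rho> (Z \<union> CB)"
      using fin_link[OF _ Z(2)] Z(1) unfolding S_def by (intro new) auto
    moreover have "g \<notin> Z \<union> CB" using Z(1) gE unfolding S_def by auto
    ultimately have gd: "del_keeps E r V \<rho> g" unfolding del_keeps_def by blast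
    have "1 + r ({x} \<union> B \<union> S \<union> {g}) + r {g} \<le> r ({x} \<union> X \<union> {g}) + r (B \<union> (S - X) \<union> {g})"
      if X: "X \<subseteq> S" for X
    proof -
      have le: "r ({x} \<union> B \<union> S \<union> {g}) \<le> r E" using AB AE xE gE unfolding S_def by (intro r_mono) auto
      show ?thesis
      proof (cases "X = {}")
        case True
        have "B \<union> (S - X) \<union> {g} = E - {e, x}" using True AB x g xB unfolding S_def by blast
        moreover have "x \<noteq> e" using x A(2) by auto
        moreover have "{x} \<union> X \<union> {g} = {x, g}" using True by auto
        ultimately show ?thesis
          using le pair_rank[OF xE gE(1)] pair_rank[OF eE xE] single_rank[OF gE(1)] g by simp
      next
        case False
        then obtain y where y: "y \<in> X" by auto
        have "2 \<le> card (insert x X)"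
          using y X fS finite_subset[OF X fS] unfolding S_def by (intro two_le_card[of _ x y]) auto
        moreover have "insert x X \<subset> A" using X x g unfolding S_def by auto
        ultimately have "r E + 2 \<le> r (insert x X) + r (E - {e} - insert x X)" by (intro proper) auto
        moreover have "r (E - {e} - insert x X) \<le> r (B \<union> (S - X) \<union> {g})"
          using AB unfolding S_def by (intro r_mono) blast
        moreover have "r (insert x X) \<le> r ({x} \<union> X \<union> {g})" by (rule r_mono) auto
        ultimately show ?thesis using le r_single[of g] by linarith
      qed
    qed
    then obtain Z' where Z': "{g} \<subseteq> Z'" "Z' \<subseteq> {g} \<union> S"
      "1 + r ({x} \<union> B \<union> Z') + r Z' \<le> r ({x} \<union> Z') + r (B \<union> Z')"
      using linking[OF rf fS, of 1 "{x}" B "{g}"] by auto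
    have "Z' \<subseteq> A - {x}" using Z'(2) g unfolding S_def by auto
    then have "minor_rep E r V \<rho> (Z' \<union> CB)"
      using fin_link[OF _ Z'(3)] by (intro new) auto
    then have "con_keeps E r V \<rho> g" using Z'(1) unfolding con_keeps_def by auto
    then show ?thesis using gd gE gF by blast
  qed
qed

end

text \<open>The state of the walk along a fan with element set \<open>Y\<close> and current end \<open>w\<close>.\<close>

definition fan_end where
  "fan_end E r V \<rho> T F Y p q w \<longleftrightarrow>
     Y \<in> T \<and> connf E r Y \<le> 2 \<and> connf E r (Y - {w}) \<le> 2 \<and> {p, q, w} \<subseteq> Y \<and>
     triangle E r {p, q, w} \<and> w \<notin> F \<and> del_keeps E r V \<rho> w \<and> \<not> del_3conn E r p"

section \<open>Walking along fans\<close>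

context stuck_minor
begin

lemma line_meets_F_once:
  assumes "L \<in> T" "connf E r L \<le> 2" "a \<in> L" "a \<notin> F" "b \<in> L" "b \<in> F" "c \<in> L" "c \<in> F"
  shows "b = c"
proof (rule ccontr)
  assume "b \<noteq> c"
  have "finite (L \<inter> F)" using F_E fin finite_subset by blast
  then have "2 \<le> card (L \<inter> F)" using assms \<open>b \<noteq> c\<close> by (intro two_le_card[of _ b c]) auto
  then show False using F_line[OF assms(1,2)] assms(3,4) by auto
qed

lemma four_fan:
  assumes "triad E r {a, s, t}" "triangle E r {a, s, z}" "z \<noteq> t"
  shows "connf E r {a, s, t, z} \<le> 2" "{a, s, t, z} \<in> T"
proof -
  have z: "z \<notin> {a, s, t}" "z \<in> E" using assms unfolding triangle_def card3_distinct by auto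
  have eq: "insert z {a, s, t} = {a, s, t, z}" by auto
  have "connf E r (insert z {a, s, t}) \<le> connf E r {a, s, t}"
    using assms z unfolding triad_def by (intro triangle_Un_conn[of a s]) auto
  then show c: "connf E r {a, s, t, z} \<le> 2" using triad_conn[OF assms(1)] unfolding eq by simp
  show "{a, s, t, z} \<in> T"
    using T_insert[OF triad_conn(2)[OF assms(1)] z(2)] c unfolding eq by blast
qed

text \<open>The triangle lemma at \<open>w\<close> and \<open>p\<close> adds a triad
  \<open>{w, u, z}\<close>. If \<open>z\<close> is outside \<open>F\<close>, the triad is the end
  triangle of a longer fan in the dual, and exchange in series makes \<open>z\<close> removable
  there. If \<open>z\<close> is in \<open>F\<close>, nothing else near the fan is, and the walk
  restarts towards \<open>v\<close> on the four-element fan \<open>{w, u, z, v}\<close>, which meets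
  \<open>F\<close> in \<open>z\<close>.\<close>

lemma fan_step:
  assumes fe: "fan_end E r V \<rho> T F Y p q w"
  shows "(\<exists>z \<in> E - Y. \<exists>u. fan_end E (dual_rank E r) V (dual_rank V \<rho>) T F (insert z Y) w u z) \<or>
    (Y \<inter> F = {} \<and> (\<exists>Y' p' q' w'. fan_end E r V \<rho> T F Y' p' q' w' \<and> Y' \<inter> F \<noteq> {}))"
proof -
  have Y: "Y \<in> T" "connf E r Y \<le> 2" "connf E r (Y - {w}) \<le> 2" "p \<in> Y" "q \<in> Y" "w \<in> Y"
    and tri: "triangle E r {p, q, w}" and w: "w \<notin> F" "del_keeps E r V \<rho> w" and p: "\<not> del_3conn E r p"
    using fe unfolding fan_end_def by auto
  have YE: "Y \<subseteq> E" using T_sub Y by auto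
  have fY: "finite Y" using YE fin finite_subset by blast
  have pqw: "p \<noteq> q" "p \<noteq> w" "q \<noteq> w" "r {p, q, w} \<le> 2"
    using tri unfolding triangle_def card3_distinct by auto
  have "w \<in> E - F" using YE Y w by auto
  then have nw: "\<not> del_3conn E r w" using stuck_del w by auto
  have "triangle E r {w, p, q}" using tri by (simp add: insert_commute)
  then obtain z where z: "z \<notin> {w, p, q}" "triad E r {w, p, z} \<or> triad E r {w, q, z}"
    using tutte_triangle[OF _ nw p] by blast
  then obtain u v where uv: "triad E r {w, u, z}" "{u, v} = {p, q}" by auto
  have uv': "u \<in> Y" "v \<in> Y" "u \<noteq> v" "u \<noteq> w" "v \<noteq> w" "z \<noteq> u" "z \<noteq> v" "z \<noteq> w" "{u, v, w} = {p, q, w}"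
    using uv(2) Y pqw z(1) by (auto simp: doubleton_eq_iff)
  have zE: "z \<in> E" and rz: "r (E - {w, u, z}) + 1 \<le> r E" using uv(1) unfolding triad_def by auto
  \<comment> \<open>A triad inside \<open>Y\<close> would put \<open>w\<close> in both the closure
    and the coclosure of \<open>Y - {w}\<close>, so that \<open>Y\<close> would have connectivity at
    most 1.\<close>
  have zY: "z \<notin> Y"
  proof
    assume zY: "z \<in> Y"
    have "r Y + r {p, q} \<le> r (Y - {w}) + r {p, q, w}" using Y pqw by (intro r_sub) auto
    then have 1: "r Y \<le> r (Y - {w})" using pair_rank(1)[of p q] pqw subsetD[OF YE] Y(4,5) by simp
    have "r (E - {u, z}) + r (E - Y) \<le> r (E - (Y - {w})) + r (E - {w, u, z})"
      using uv' zY Y YE by (intro r_sub) auto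
    then have "r (E - Y) + 1 \<le> r (E - (Y - {w}))" 
      using rz pair_rank(2)[of u z] uv'(1,6) zE subsetD[OF YE] by simp
    then have "connf E r Y \<le> 1" using 1 Y(3) unfolding connf_def by linarith
    moreover have "2 \<le> card Y" using two_le_card[OF fY] Y pqw by auto
    ultimately show False using conn3[OF YE _ T_compl_big[OF Y(1)]] by simp
  qed
  let ?Y = "insert z Y"
  have "triad E r {u, w, z}" using uv(1) by (simp add: insert_commute)
  then have c: "connf E r ?Y \<le> 2"
    using triad_Un_conn[of u w z Y] uv' Y zY YE by simp
  have YT: "?Y \<in> T" using T_insert[OF Y(1) zE c] .
  have wV: "w \<notin> V" using w VF by auto
  show ?thesis
  proof (cases "z \<in> F")
    case False
    then have zV: "z \<notin> V" using VF by auto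
    have "triad E r {w, z, u}" using uv(1) by (simp add: insert_commute)
    then have "con_keeps E r V \<rho> z" using triad_series[of w z u] wV zV w(2) by auto
    moreover have "\<not> con_3conn E r w" using triangle_not_con[OF tri] by auto
    moreover have "?Y - {z} = Y" using zY by auto
    ultimately have "fan_end E (dual_rank E r) V (dual_rank V \<rho>) T F ?Y w u z"
      using YT c uv uv' Y False zE zV YE
      unfolding fan_end_def by (simp add: connf_dual triangle_dual keeps_dual del_3conn_dual subset_iff)
    then show ?thesis using zY zE by blast
  next
    case True
    have once: "y = z" if "y \<in> ?Y" "y \<in> F" for y
      using line_meets_F_once[OF YT c, of w y z] that True Y w by auto
    have "Y \<inter> F = {}" using once zY by auto
    then have uvF: "u \<notin> V" "v \<notin> V" "v \<notin> F" using uv' VF by auto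
    have "con_keeps E r V \<rho> u" using triad_series[of w u z] uv(1) wV uvF w(2) by auto
    moreover have tri': "triangle E r {u, v, w}" "triangle E r {w, u, v}"
      using tri uv'(9) by (simp_all add: insert_commute)
    ultimately have "del_keeps E r V \<rho> v" using triangle_parallel[of u v w] uvF by auto
    moreover have "\<not> del_3conn E r w" by (rule nw)
    moreover have "connf E r {w, u, z, v} \<le> 2" "{w, u, z, v} \<in> T"
      using four_fan[OF uv(1) tri'(2)] uv' by auto
    moreover have "{w, u, z, v} - {v} = {w, u, z}" using uv' by auto
    ultimately have "fan_end E r V \<rho> T F {w, u, z, v} w u v"
      using triad_conn(1)[OF uv(1)] tri' uvF unfolding fan_end_def by auto
    then show ?thesis using \<open>Y \<inter> F = {}\<close> True by blast
  qed
qed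

end

lemma no_fan_end:
  assumes "stuck_minor E r T F V \<rho>" "fan_end E r V \<rho> T F Y p q w"
  shows False
  using assms
\<comment> \<open>Extensions decrease \<open>card (E - Y)\<close>. A restart may shrink
  \<open>Y\<close>, but it happens only while \<open>Y\<close> avoids \<open>F\<close> and ends with
  \<open>Y\<close> meeting \<open>F\<close>, so the surcharge \<open>Suc (card E)\<close> pays for
  it.\<close>
proof (induction "card (E - Y) + (if Y \<inter> F = {} then Suc (card E) else 0)"
    arbitrary: r \<rho> Y p q w rule: less_induct)
  case less
  interpret stuck_minor E r T F V \<rho> by (rule less.prems(1))
  from fan_step[OF less.prems(2)] show False
  proof
    assume "\<exists>z \<in> E - Y. \<exists>u. fan_end E (dual_rank E r) V (dual_rank V \<rho>) T F (insert z Y) w u z"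
    then obtain z u where z: "z \<in> E - Y"
      and fe: "fan_end E (dual_rank E r) V (dual_rank V \<rho>) T F (insert z Y) w u z" by blast
    have "E - insert z Y \<subset> E - Y" using z by auto
    then have "card (E - insert z Y) < card (E - Y)" using fin by (intro psubset_card_mono) auto
    then show False by (intro less.hyps[OF _ stuck_dual fe]) auto
  next
    assume "Y \<inter> F = {} \<and> (\<exists>Y' p' q' w'. fan_end E r V \<rho> T F Y' p' q' w' \<and> Y' \<inter> F \<noteq> {})"
    then obtain Y' p' q' w' where *: "Y \<inter> F = {}" "fan_end E r V \<rho> T F Y' p' q' w'" "Y' \<inter> F \<noteq> {}"
      by blast
    have "card (E - Y') \<le> card E" using fin by (intro card_mono) auto
    then show False using * by (intro less.hyps[OF _ less.prems(1) *(2)]) auto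
  qed
qed

context stuck_minor
begin

text \<open>The ends of the fan are \<open>z\<close> and \<open>t\<close>, and at most one of its
  elements is in \<open>F\<close>. The walk leaves through \<open>z\<close> if \<open>z\<close> is
  outside \<open>F\<close>, and through \<open>t\<close> in the dual otherwise; exchange through the
  triangle, and then the triad, makes that end removable.\<close>

lemma no_four_fan:
  assumes td: "triad E r {a, s, t}" and tg: "triangle E r {a, s, z}" and "z \<noteq> t"
    and a: "a \<notin> F" "con_keeps E r V \<rho> a"
  shows False
proof -
  interpret D: stuck_minor E "dual_rank E r" T F V "dual_rank V \<rho>" by (rule stuck_dual)
  let ?Y = "{a, s, t, z}"
  have Y: "connf E r ?Y \<le> 2" "?Y \<in> T" using four_fan[OF td tg \<open>z \<noteq> t\<close>] by auto
  have dist: "a \<noteq> s" "a \<noteq> t" "s \<noteq> t" "a \<noteq> z" "s \<noteq> z"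
    using td tg unfolding triad_def triangle_def card3_distinct by auto
  have YE: "a \<in> E" "s \<in> E" "t \<in> E" "z \<in> E" using td tg unfolding triad_def triangle_def by auto
  have aV: "a \<notin> V" using a VF by auto
  show False
  proof (cases "z \<in> F")
    case False
    have "triangle E r {a, z, s}" using tg by (simp add: insert_commute)
    then have "del_keeps E r V \<rho> z" using triangle_parallel[of a z s] aV False VF a by auto
    moreover have "\<not> del_3conn E r a" using triad_not_del[OF td] by auto
    moreover have "?Y - {z} = {a, s, t}" using dist \<open>z \<noteq> t\<close> by auto
    ultimately have "fan_end E r V \<rho> T F ?Y a s z"
      using Y tg False triad_conn(1)[OF td] unfolding fan_end_def by auto
    then show False by (rule no_fan_end[OF stuck_minor_axioms])
  next
    case True
    have "s \<notin> F" "t \<notin> F"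
      using line_meets_F_once[OF Y(2,1), of a s z] line_meets_F_once[OF Y(2,1), of a t z]
        a True dist \<open>z \<noteq> t\<close> by auto
    then have V: "s \<notin> V" "t \<notin> V" using VF by auto
    have "del_keeps E r V \<rho> s" using triangle_parallel[OF tg] aV V a by auto
    moreover have "triad E r {s, t, a}" using td by (simp add: insert_commute)
    ultimately have "con_keeps E r V \<rho> t" using triad_series[of s t a] V by auto
    moreover have "\<not> con_3conn E r a" using triangle_not_con[OF tg] by auto
    moreover have "?Y - {t} = {a, s, z}" using dist \<open>z \<noteq> t\<close> by auto
    ultimately have "fan_end E (dual_rank E r) V (dual_rank V \<rho>) T F ?Y a s t"
      using Y td \<open>t \<notin> F\<close> V triangle_conn(1)[OF tg] YE unfolding fan_end_def
      by (simp add: connf_dual triangle_dual keeps_dual del_3conn_dual)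
    then show False using no_fan_end[OF stuck_dual] by blast
  qed
qed

lemma triad_obtain:
  assumes "triad E r S" "g \<in> S" "g \<notin> F"
  obtains u v where "S = {g, u, v}" "u \<notin> F"
proof -
  have "card (S - {g}) = 2" using assms unfolding triad_def by (simp add: card_Diff_singleton)
  then obtain u v where uv: "S - {g} = {u, v}" "u \<noteq> v" by (auto simp: card_2_iff)
  then have S: "S = {g, u, v}" "S = {g, v, u}" using assms(2) by auto
  have "u \<notin> F \<or> v \<notin> F"
    using line_meets_F_once[OF triad_conn(2,1)[OF assms(1)] assms(2,3), of u v] uv S by auto
  then show ?thesis using that S by blast
qed

text \<open>Contraction keeps \<open>N\<close> at \<open>g\<close> by assumption and at a second
  element \<open>u\<close> of the triad by series exchange. Neither contraction is 3-connected, so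
  the dual triangle lemma adds a triangle and completes a four-element fan.\<close>

lemma no_both_keep_triad:
  assumes "g \<in> E - F" "del_keeps E r V \<rho> g" "con_keeps E r V \<rho> g" "triad E r S" "g \<in> S"
  shows False
proof -
  interpret D: stuck_minor E "dual_rank E r" T F V "dual_rank V \<rho>" by (rule stuck_dual)
  obtain u v where S: "S = {g, u, v}" and u: "u \<notin> F"
    using triad_obtain[OF assms(4,5)] assms(1) by blast
  have gV: "g \<notin> V" "u \<notin> V" using assms(1) u VF by auto
  have uE: "u \<in> E" using assms(4) S unfolding triad_def by auto
  have cu: "con_keeps E r V \<rho> u" using triad_series[of g u v] assms S gV by auto
  have nc: "\<not> con_3conn E r u" "\<not> con_3conn E r g" using stuck_con assms u uE cu by auto
  have td: "triad E r {u, g, v}" "triad E r {u, v, g}" using assms(4) S by (auto simp: insert_commute)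
  have "\<exists>z. z \<notin> {u, g, v} \<and> (triangle E r {u, g, z} \<or> triangle E r {u, v, z})"
    using D.tutte_triangle[of u g v] td(1) nc uE assms(1)
    by (simp add: triangle_dual del_3conn_dual triad_dual)
  then show False using no_four_fan[OF td(1)] no_four_fan[OF td(2)] u cu by blast
qed

lemma no_both_keep:
  assumes "g \<in> E - F" "del_keeps E r V \<rho> g" "con_keeps E r V \<rho> g"
  shows False
proof -
  interpret D: stuck_minor E "dual_rank E r" T F V "dual_rank V \<rho>" by (rule stuck_dual)
  have g: "g \<in> E - V" "g \<in> E" using assms(1) VF by auto
  have "\<not> del_3conn E r g" "\<not> con_3conn E r g" using stuck_del stuck_con assms by auto
  from bixby[OF g(2) this] show False
    using no_both_keep_triad[OF assms] D.no_both_keep_triad[OF assms(1)] assms g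
    by (auto simp: keeps_dual triad_dual)
qed

text \<open>With flexible elements excluded, \<open>e\<close> lies in a triad, and an element
  \<open>a\<close> of it outside \<open>F\<close> may be contracted. The same reasoning in the dual
  puts \<open>a\<close> in a triangle, which by orthogonality shares a second element with the
  triad: a four-element fan.\<close>

lemma no_del_keeps:
  assumes "e \<in> E - F" "del_keeps E r V \<rho> e"
  shows False
proof -
  interpret D: stuck_minor E "dual_rank E r" T F V "dual_rank V \<rho>" by (rule stuck_dual)
  obtain S where S: "triad E r S" "e \<in> S"
    using separation_both_keep[OF assms] no_both_keep by blast
  obtain a b where ab: "S = {e, a, b}" and aF: "a \<notin> F"
    using triad_obtain[OF S] assms(1) by blast
  have aE: "a \<in> E" "a \<in> E - V" "a \<in> E - F" "e \<notin> V"
    using S ab aF VF assms(1) unfolding triad_def by auto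
  have ca: "con_keeps E r V \<rho> a" using triad_series[of e a b] S ab aE assms by auto
  have "\<exists>S'. triangle E r S' \<and> a \<in> S'"
  proof (rule ccontr)
    assume "\<not> ?thesis"
    then have "\<And>S. triad E (dual_rank E r) S \<Longrightarrow> a \<notin> S" by (auto simp: triad_dual)
    moreover have "del_keeps E (dual_rank E r) V (dual_rank V \<rho>) a"
      using ca keeps_dual[OF aE(2)] by simp
    ultimately show False using D.separation_both_keep[OF aE(3)] D.no_both_keep by blast
  qed
  then obtain S' where S': "triangle E r S'" "a \<in> S'" by blast
  have "card (S' - {a}) = 2" using S' unfolding triangle_def by (simp add: card_Diff_singleton)
  then obtain c d where cd: "S' - {a} = {c, d}" "c \<noteq> d" by (auto simp: card_2_iff)
  have acd: "S' = {a, c, d}" "S' = {a, d, c}" "a \<noteq> c" "a \<noteq> d" using cd S'(2) by auto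
  have td: "triad E r {a, e, b}" "triad E r {a, b, e}" using S ab by (auto simp: insert_commute)
  have dist: "a \<noteq> e" "a \<noteq> b" "e \<noteq> b" using td(1) unfolding triad_def card3_distinct by auto
  have "c \<in> S \<or> d \<in> S" using orthogonal[of S a c d] S S' acd ab by auto
  then obtain c' d' where cd': "S' = {a, c', d'}" "c' \<in> S" "a \<noteq> c'" "a \<noteq> d'" "c' \<noteq> d'"
    using acd cd(2) by metis
  show False
  proof (cases "d' \<in> S")
    case True
    \<comment> \<open>A set that is both triangle and triad would have connectivity at most
      1.\<close>
    have "S' \<subseteq> S" unfolding cd'(1) using cd'(2) True ab by blast
    then have "S' = S"
      using S(1) S'(1) finite_subset[OF _ fin] unfolding triad_def triangle_def
      by (intro card_subset_eq) auto
    then have c1: "r S \<le> 2" "r (E - S) + 1 \<le> r E" using S S' unfolding triangle_def triad_def by auto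
    have "2 \<le> connf E r S"
      using S triad_conn[OF S(1)] by (intro conn3 T_compl_big) (auto simp: triad_def)
    then show False using c1 unfolding connf_def by simp
  next
    case False
    then consider "c' = e" | "c' = b" using cd' ab by auto
    then show False
    proof cases
      case 1
      then show False using no_four_fan[OF td(1), of d'] S' cd' False aF ca ab by auto
    next
      case 2
      then show False using no_four_fan[OF td(2), of d'] S' cd' False aF ca ab by auto
    qed
  qed
qed

theorem stuck_False: False
proof -
  interpret D: stuck_minor E "dual_rank E r" T F V "dual_rank V \<rho>" by (rule stuck_dual)
  obtain e where e: "e \<in> E - F" using T_compl_big[OF F_T] two_le_card_obtain by metis
  obtain C where "minor_rep E r V \<rho> C" using ex_rep by blast
  then have "del_keeps E r V \<rho> e \<or> con_keeps E r V \<rho> e" unfolding del_keeps_def con_keeps_def by auto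
  then show False
    using no_del_keeps[OF e] D.no_del_keeps[OF e] keeps_dual[of e] e VF by auto
qed

end

section \<open>Matroids and their rank functions\<close>

abbreviation rki :: "'a matroid \<Rightarrow> 'a set \<Rightarrow> int" where
  "rki M X \<equiv> int (rk M X)"

lemma matroidD:
  assumes "matroid M"
  shows "finite (ground M)" "indep M {}" "indep M X \<Longrightarrow> X \<subseteq> ground M"
    "indep M Y \<Longrightarrow> X \<subseteq> Y \<Longrightarrow> indep M X"
    "indep M X \<Longrightarrow> indep M Y \<Longrightarrow> card X < card Y \<Longrightarrow> \<exists>e \<in> Y - X. indep M (insert e X)"
  using assms unfolding matroid_def by blast+

lemma rk_set:
  assumes "matroid M"
  shows "finite {card I | I. I \<subseteq> X \<and> indep M I}" "{card I | I. I \<subseteq> X \<and> indep M I} \<noteq> {}"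
proof -
  have "{card I | I. I \<subseteq> X \<and> indep M I} \<subseteq> card ` Pow (ground M)"
    using matroidD(3)[OF assms] by auto
  then show "finite {card I | I. I \<subseteq> X \<and> indep M I}"
    using matroidD(1)[OF assms] finite_subset by blast
  show "{card I | I. I \<subseteq> X \<and> indep M I} \<noteq> {}" using matroidD(2)[OF assms] by blast
qed

lemma rk_ge: "matroid M \<Longrightarrow> I \<subseteq> X \<Longrightarrow> indep M I \<Longrightarrow> card I \<le> rk M X"
  unfolding rk_def using rk_set[of M X] by (intro Max_ge) auto

lemma rk_basis:
  assumes "matroid M" obtains I where "I \<subseteq> X" "indep M I" "card I = rk M X"
  using Max_in[OF rk_set[OF assms, of X]] that unfolding rk_def by auto

lemma rk_extend:
  assumes M: "matroid M" and "I \<subseteq> X" "indep M I"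
  shows "\<exists>J. I \<subseteq> J \<and> J \<subseteq> X \<and> indep M J \<and> card J = rk M X"
  using assms(2,3)
proof (induction "rk M X - card I" arbitrary: I rule: less_induct)
  case less
  show ?case
  proof (cases "card I = rk M X")
    case True
    then show ?thesis using less.prems by blast
  next
    case False
    then have lt: "card I < rk M X" using rk_ge[OF M less.prems] by simp
    obtain B where B: "B \<subseteq> X" "indep M B" "card B = rk M X" using rk_basis[OF M] .
    then obtain e where e: "e \<in> B - I" "indep M (insert e I)"
      using matroidD(5)[OF M less.prems(2) B(2)] lt by auto
    have "finite I" using matroidD(1,3)[OF M] less.prems(2) finite_subset by metis
    then have "card (insert e I) = Suc (card I)" using e by auto
    then have "\<exists>J. insert e I \<subseteq> J \<and> J \<subseteq> X \<and> indep M J \<and> card J = rk M X"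
      using e B less.prems lt by (intro less.hyps) auto
    then show ?thesis by blast
  qed
qed

lemma rank_fun_rk:
  assumes M: "matroid M" shows "rank_fun (ground M) (rki M)"
proof
  show "finite (ground M)" using matroidD(1)[OF M] .
  have fin: "finite I" if "indep M I" for I
    using matroidD(1,3)[OF M] that finite_subset by metis
  have "I = {}" if "I \<subseteq> {}" for I :: "'a set" using that by auto
  then show "rki M {} = 0" using rk_basis[OF M, of "{}"] by (metis card.empty of_nat_0)
  show "rki M X \<le> rki M Y" if "X \<subseteq> Y" for X Y
    using rk_basis[OF M, of X] rk_ge[OF M, of _ Y] that by (metis of_nat_mono order_trans)
  show "rki M {e} \<le> 1" for e
  proof -
    obtain I where "I \<subseteq> {e}" "card I = rk M {e}" using rk_basis[OF M] .
    then show ?thesis using card_mono[of "{e}" I] by simp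
  qed
  show "rki M (X \<inter> ground M) = rki M X" for X
  proof -
    have "{card I | I. I \<subseteq> X \<inter> ground M \<and> indep M I} = {card I | I. I \<subseteq> X \<and> indep M I}"
      using matroidD(3)[OF M] by blast
    then show ?thesis unfolding rk_def by simp
  qed
  show "rki M (X \<union> Y) + rki M (X \<inter> Y) \<le> rki M X + rki M Y" for X Y
  proof -
    obtain I where I: "I \<subseteq> X \<inter> Y" "indep M I" "card I = rk M (X \<inter> Y)" using rk_basis[OF M] .
    then obtain J where J: "I \<subseteq> J" "J \<subseteq> X \<union> Y" "indep M J" "card J = rk M (X \<union> Y)"
      using rk_extend[OF M, of I "X \<union> Y"] by auto
    have fJ: "finite J" using fin J by auto
    have "card (J \<inter> X) + card (J \<inter> Y) = card ((J \<inter> X) \<union> (J \<inter> Y)) + card ((J \<inter> X) \<inter> (J \<inter> Y))"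
      using fJ by (intro card_Un_Int) auto
    moreover have "(J \<inter> X) \<union> (J \<inter> Y) = J" using J by auto
    moreover have "card I \<le> card ((J \<inter> X) \<inter> (J \<inter> Y))" using I J fJ by (intro card_mono) auto
    moreover have "card (J \<inter> X) \<le> rk M X" "card (J \<inter> Y) \<le> rk M Y"
      using matroidD(4)[OF M J(3)] by (auto intro!: rk_ge[OF M])
    ultimately show ?thesis using I J by simp
  qed
qed

lemma indep_iff_rk:
  assumes M: "matroid M" shows "indep M X \<longleftrightarrow> X \<subseteq> ground M \<and> rk M X = card X"
proof
  assume X: "indep M X"
  then have XE: "X \<subseteq> ground M" using matroidD(3)[OF M] by auto
  then have "finite X" using matroidD(1)[OF M] finite_subset by blast
  then have "rki M X \<le> int (card X)" using rank_fun.r_card[OF rank_fun_rk[OF M]] by auto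
  then show "X \<subseteq> ground M \<and> rk M X = card X" using rk_ge[OF M order_refl X] XE by simp
next
  assume X: "X \<subseteq> ground M \<and> rk M X = card X"
  then have "finite X" using matroidD(1)[OF M] finite_subset by blast
  moreover obtain I where "I \<subseteq> X" "indep M I" "card I = rk M X" using rk_basis[OF M] .
  ultimately show "indep M X" using X card_subset_eq by metis
qed

context rank_fun
begin

lemma r_closure:
  assumes "finite Y" "\<And>e. e \<in> Y \<Longrightarrow> r (insert e X) \<le> r X" shows "r (X \<union> Y) \<le> r X"
  using assms
proof (induction Y rule: finite_induct)
  case (insert e Y)
  have "r (X \<union> insert e Y) + r X \<le> r (insert e X) + r (X \<union> Y)" by (rule r_sub) auto
  then show ?case using insert by fastforce
qed simp

text \<open>The route from rank functions back to matroids: a minor is identified with this matroid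
  for \<open>minor_rank\<close>, which yields its axioms and its rank function together.\<close>

definition matroid_of_rank :: "'a matroid" where
  "matroid_of_rank = (E, \<lambda>X. X \<subseteq> E \<and> r X = int (card X))"

lemma indep_of_rank: "indep matroid_of_rank X \<longleftrightarrow> X \<subseteq> E \<and> r X = int (card X)"
  and ground_of_rank: "ground matroid_of_rank = E"
  unfolding matroid_of_rank_def indep_def ground_def by auto

lemma not_indep_insert:
  assumes "indep matroid_of_rank X" "e \<in> E" "\<not> indep matroid_of_rank (insert e X)"
  shows "r (insert e X) \<le> r X"
proof (cases "e \<in> X")
  case False
  have "finite X" using assms(1) fin finite_subset unfolding indep_of_rank by blast
  then have "card (insert e X) = Suc (card X)" using False by simp
  then show ?thesis using assms r_insert[of e X] unfolding indep_of_rank by auto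
qed (simp add: insert_absorb)

lemma matroid_of_rank: "matroid matroid_of_rank"
proof -
  have her: "indep matroid_of_rank X" if "indep matroid_of_rank Y" "X \<subseteq> Y" for X Y
  proof -
    have Y: "Y \<subseteq> E" "r Y = int (card Y)" using that unfolding indep_of_rank by auto
    have fY: "finite Y" using Y(1) fin finite_subset by blast
    have fX: "finite X" using that(2) fY finite_subset by blast
    have "r (X \<union> (Y - X)) \<le> r X + int (card (Y - X))" using fY by (intro r_Un_card) auto
    moreover have "X \<union> (Y - X) = Y" using that by auto
    moreover have "card (Y - X) = card Y - card X" "card X \<le> card Y"
      using card_Diff_subset[OF fX that(2)] card_mono[OF fY that(2)] by auto
    ultimately have "int (card X) \<le> r X" using Y by simp
    then show ?thesis using r_card[OF fX] Y(1) that(2) unfolding indep_of_rank by auto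
  qed
  moreover have "\<exists>e \<in> Y - X. indep matroid_of_rank (insert e X)"
    if "indep matroid_of_rank X" "indep matroid_of_rank Y" "card X < card Y" for X Y
  proof (rule ccontr)
    assume no: "\<not> ?thesis"
    have Y: "Y \<subseteq> E" "finite Y" using that(2) fin finite_subset unfolding indep_of_rank by blast+
    have "r (X \<union> Y) \<le> r X"
    proof (rule r_closure[OF Y(2)])
      fix e assume "e \<in> Y"
      then show "r (insert e X) \<le> r X"
        using no not_indep_insert[OF that(1)] Y by (cases "e \<in> X") (auto simp: insert_absorb)
    qed
    moreover have "r Y \<le> r (X \<union> Y)" by (rule r_mono) auto
    ultimately show False using that unfolding indep_of_rank by simp
  qed
  moreover have "indep matroid_of_rank {}" using r_empty unfolding indep_of_rank by simp
  moreover have "\<forall>X. indep matroid_of_rank X \<longrightarrow> X \<subseteq> E" unfolding indep_of_rank by simp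
  ultimately show ?thesis unfolding matroid_def ground_of_rank using fin by blast
qed

lemma rk_of_rank: "rki matroid_of_rank X = r X"
proof -
  obtain I where I: "I \<subseteq> X" "indep matroid_of_rank I" "card I = rk matroid_of_rank X"
    using rk_basis[OF matroid_of_rank] .
  have IE: "I \<subseteq> E" "r I = int (card I)" using I(2) unfolding indep_of_rank by auto
  have fI: "finite I" using IE fin finite_subset by blast
  have "r (I \<union> (X \<inter> E)) \<le> r I"
  proof (rule r_closure)
    show "finite (X \<inter> E)" using fin by auto
    fix e assume e: "e \<in> X \<inter> E"
    show "r (insert e I) \<le> r I"
    proof (cases "e \<in> I")
      case False
      have "\<not> indep matroid_of_rank (insert e I)"
      proof
        assume "indep matroid_of_rank (insert e I)"
        then have "card (insert e I) \<le> rk matroid_of_rank X"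
          using e I by (intro rk_ge[OF matroid_of_rank]) auto
        then show False using I fI False by simp
      qed
      then show ?thesis using not_indep_insert[OF I(2)] e by auto
    qed (simp add: insert_absorb)
  qed
  moreover have "r (X \<inter> E) \<le> r (I \<union> (X \<inter> E))" by (rule r_mono) auto
  moreover have "r I \<le> r X" using I by (intro r_mono) auto
  ultimately show ?thesis using IE I r_supp[of X] by simp
qed

end

section \<open>Minors through their rank functions\<close>

definition minor_rank :: "('a set \<Rightarrow> int) \<Rightarrow> 'a set \<Rightarrow> 'a set \<Rightarrow> 'a set \<Rightarrow> int" where
  "minor_rank r E' C X = r ((X \<inter> E') \<union> C) - r C"

lemma (in rank_fun) rank_fun_minor: "E' \<subseteq> E \<Longrightarrow> rank_fun E' (minor_rank r E' C)"
proof
  assume E': "E' \<subseteq> E"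
  show "finite E'" using E' fin finite_subset by blast
  show "minor_rank r E' C {} = 0" unfolding minor_rank_def by simp
  show "minor_rank r E' C X \<le> minor_rank r E' C Y" if "X \<subseteq> Y" for X Y
  proof -
    have "r ((X \<inter> E') \<union> C) \<le> r ((Y \<inter> E') \<union> C)" using that by (intro r_mono) auto
    then show ?thesis unfolding minor_rank_def by simp
  qed
  show "minor_rank r E' C (X \<union> Y) + minor_rank r E' C (X \<inter> Y)
      \<le> minor_rank r E' C X + minor_rank r E' C Y" for X Y
  proof -
    have "r (((X \<union> Y) \<inter> E') \<union> C) + r (((X \<inter> Y) \<inter> E') \<union> C) \<le> r ((X \<inter> E') \<union> C) + r ((Y \<inter> E') \<union> C)"
      by (rule r_sub) auto
    then show ?thesis unfolding minor_rank_def by simp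
  qed
  show "minor_rank r E' C {e} \<le> 1" for e
  proof -
    have "r (({e} \<inter> E') \<union> C) \<le> r C + 1" by (rule r_remove[of _ e]) auto
    then show ?thesis unfolding minor_rank_def by simp
  qed
  show "minor_rank r E' C (X \<inter> E') = minor_rank r E' C X" for X
    unfolding minor_rank_def by (simp add: Int_assoc)
qed

lemma minor_matroid:
  assumes M: "matroid M"
  shows "matroid (delete (contract M C) D)"
    and "ground (delete (contract M C) D) = ground M - C - D"
    and "rki (delete (contract M C) D) X = minor_rank (rki M) (ground M - C - D) C X"
proof -
  let ?E = "ground M - C - D" and ?r = "minor_rank (rki M) (ground M - C - D) C"
  interpret R: rank_fun "ground M" "rki M" by (rule rank_fun_rk[OF M])
  interpret S: rank_fun ?E ?r by (rule R.rank_fun_minor) auto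
  have "indep (delete (contract M C) D) X \<longleftrightarrow> indep S.matroid_of_rank X" for X
  proof -
    have "?r X = int (card X) \<longleftrightarrow> rk M (X \<union> C) = card X + rk M C" if "X \<subseteq> ?E"
      using that unfolding minor_rank_def by (auto simp: Int_absorb2)
    then show ?thesis
      unfolding S.indep_of_rank by (auto simp: delete_def contract_def indep_def)
  qed
  then have "indep (delete (contract M C) D) = indep S.matroid_of_rank" by blast
  moreover show g: "ground (delete (contract M C) D) = ?E"
    by (simp add: delete_def contract_def ground_def)
  ultimately have eq: "delete (contract M C) D = S.matroid_of_rank"
    using S.ground_of_rank by (simp add: ground_def indep_def prod_eq_iff)
  show "matroid (delete (contract M C) D)" unfolding eq by (rule S.matroid_of_rank)
  show "rki (delete (contract M C) D) X = ?r X" unfolding eq by (rule S.rk_of_rank)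
qed

text \<open>\<open>has_minor\<close> demands equality of pairs, hence of independence predicates on
  all sets; independent sets lie in the ground set, so ranks of its subsets decide.\<close>

lemma matroid_eqI:
  assumes "matroid M" "matroid N" "ground M = ground N" "\<And>X. X \<subseteq> ground M \<Longrightarrow> rk M X = rk N X"
  shows "M = N"
proof -
  have "indep M X = indep N X" for X using assms by (auto simp: indep_iff_rk)
  then have "indep M = indep N" by blast
  then show ?thesis using assms(3) by (simp add: ground_def indep_def prod_eq_iff)
qed

lemma has_minor_iff:
  assumes M: "matroid M"
  shows "has_minor M N \<longleftrightarrow> matroid N \<and> ground N \<subseteq> ground M \<and>
    (\<exists>C. minor_rep (ground M) (rki M) (ground N) (rki N) C)"
proof
  assume "has_minor M N"
  then obtain C D where CD: "C \<subseteq> ground M" "D \<subseteq> ground M" "C \<inter> D = {}" "N = delete (contract M C) D"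
    unfolding has_minor_def by auto
  note N = minor_matroid[OF M, of C D, folded CD(4)]
  have "minor_rep (ground M) (rki M) (ground N) (rki N) C"
    using CD N(2) unfolding minor_rep_def N(3) minor_rank_def by (auto simp: Int_absorb2)
  then show "matroid N \<and> ground N \<subseteq> ground M \<and> (\<exists>C. minor_rep (ground M) (rki M) (ground N) (rki N) C)"
    using N by auto
next
  assume *: "matroid N \<and> ground N \<subseteq> ground M \<and> (\<exists>C. minor_rep (ground M) (rki M) (ground N) (rki N) C)"
  then obtain C where C: "C \<subseteq> ground M - ground N"
    and rep: "\<And>X. X \<subseteq> ground N \<Longrightarrow> rki M (X \<union> C) - rki M C = rki N X"
    unfolding minor_rep_def by auto
  let ?D = "ground M - ground N - C"
  have g: "ground M - C - ?D = ground N" using C * by auto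
  have "N = delete (contract M C) ?D"
  proof (rule matroid_eqI)
    fix X assume X: "X \<subseteq> ground N"
    have "rki (delete (contract M C) ?D) X = rki N X"
      unfolding minor_matroid(3)[OF M] minor_rank_def g using rep[OF X] X by (simp add: Int_absorb2)
    then show "rk N X = rk (delete (contract M C) ?D) X" by simp
  qed (use * minor_matroid[OF M] g in auto)
  moreover have "C \<subseteq> ground M" "?D \<subseteq> ground M" "C \<inter> ?D = {}" using C by auto
  ultimately show "has_minor M N" unfolding has_minor_def by blast
qed

text \<open>The subtraction in \<open>conn\<close> is truncated; nonnegativity of connectivity shows
  that nothing is cut off.\<close>

lemma conn_connf:
  assumes M: "matroid M" "X \<subseteq> ground M"
  shows "int (conn M X) = connf (ground M) (rki M) X"
proof -
  interpret rank_fun "ground M" "rki M" by (rule rank_fun_rk[OF M(1)])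
  have "0 \<le> connf (ground M) (rki M) X" by (rule connf_nonneg[OF M(2)])
  then show ?thesis unfolding conn_def matroid_rank_def connf_def by auto
qed

lemma three_connected_iff:
  "three_connected M \<longleftrightarrow> matroid M \<and> (\<forall>X \<subseteq> ground M.
     (1 \<le> card X \<longrightarrow> 1 \<le> card (ground M - X) \<longrightarrow> 1 \<le> connf (ground M) (rki M) X) \<and>
     (2 \<le> card X \<longrightarrow> 2 \<le> card (ground M - X) \<longrightarrow> 2 \<le> connf (ground M) (rki M) X))"
  (is "?L \<longleftrightarrow> matroid M \<and> (\<forall>X \<subseteq> ground M. ?R X)")
proof (cases "matroid M")
  case True
  show ?thesis
  proof
    assume t: ?L
    have "?R X" if X: "X \<subseteq> ground M" for X
    proof -
      have "k \<le> conn M X" if "1 \<le> k" "k < 3" "k \<le> card X" "k \<le> card (ground M - X)" for k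
        using t that X unfolding three_connected_def by (meson not_le)
      from this[of 1] this[of 2] show ?thesis
        unfolding conn_connf[OF True X, symmetric] by auto
    qed
    then show "matroid M \<and> (\<forall>X \<subseteq> ground M. ?R X)" using True by blast
  next
    assume R: "matroid M \<and> (\<forall>X \<subseteq> ground M. ?R X)"
    have "k \<le> conn M X" if "1 \<le> k" "k < 3" "X \<subseteq> ground M" "k \<le> card X" "k \<le> card (ground M - X)" for k X
    proof -
      have "?R X" using R that(3) by blast
      moreover have "k = 1 \<or> k = 2" using that by auto
      ultimately show ?thesis
        using that(4,5) unfolding conn_connf[OF True that(3), symmetric] by auto
    qed
    then show ?L unfolding three_connected_def using True by (meson not_le)
  qed
qed (simp add: three_connected_def)

text \<open>\<open>C\<close> and \<open>D\<close> accumulate all removed elements, so consecutive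
  minors are compared through the formula for \<open>minor_rank\<close> over the original
  \<open>M\<close>.\<close>

lemma rki_delete_element:
  assumes M: "matroid M" and "X \<subseteq> ground M - C - insert e D"
  shows "rki (delete (contract M C) (insert e D)) X = rki (delete (contract M C) D) X"
proof -
  have "X \<inter> (ground M - C - insert e D) = X" "X \<inter> (ground M - C - D) = X" using assms(2) by auto
  then show ?thesis unfolding minor_matroid(3)[OF M] minor_rank_def by simp
qed

lemma rki_contract_element:
  assumes M: "matroid M" and "X \<subseteq> ground M - insert e C - D" "e \<in> ground M - C - D"
  shows "rki (delete (contract M (insert e C)) D) X
    = rki (delete (contract M C) D) (insert e X) - rki (delete (contract M C) D) {e}"
proof -
  have "X \<inter> (ground M - insert e C - D) \<union> insert e C = insert e X \<inter> (ground M - C - D) \<union> C"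
    "{e} \<inter> (ground M - C - D) \<union> C = insert e C" using assms(2,3) by auto
  then show ?thesis unfolding minor_matroid(3)[OF M] minor_rank_def by simp
qed

lemma delete_element_minor:
  fixes M :: "'a matroid" and C D
  defines "M' \<equiv> delete (contract M C) D"
  assumes M: "matroid M" and e: "e \<in> ground M'" and V: "ground N \<subseteq> ground M' - {e}"
    and N: "matroid N"
    and keeps: "del_keeps (ground M') (rki M') (ground N) (rki N) e"
  shows "has_minor (delete (contract M C) (insert e D)) N"
proof -
  let ?M = "delete (contract M C) (insert e D)"
  have gr: "ground M' = ground M - C - D" "ground ?M = ground M - C - insert e D"
    unfolding M'_def using minor_matroid(2)[OF M] by auto
  obtain B where B: "minor_rep (ground M') (rki M') (ground N) (rki N) B" "e \<notin> B"
    using keeps unfolding del_keeps_def by auto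
  have "rki ?M X = rki M' X" if "X \<subseteq> ground ?M" for X
    using rki_delete_element[OF M, of X C e D] that gr unfolding M'_def by auto
  moreover have BE: "B \<subseteq> ground ?M - ground N" using B gr unfolding minor_rep_def by auto
  moreover have "X \<union> B \<subseteq> ground ?M" if "X \<subseteq> ground N" for X using that BE V gr by auto
  ultimately have "minor_rep (ground ?M) (rki ?M) (ground N) (rki N) B"
    using B(1) unfolding minor_rep_def by auto
  moreover have "ground N \<subseteq> ground ?M" using V gr by auto
  ultimately show ?thesis
    using N unfolding has_minor_iff[OF minor_matroid(1)[OF M]] by blast
qed

lemma contract_element_minor:
  fixes M :: "'a matroid" and C D
  defines "M' \<equiv> delete (contract M C) D"
  assumes M: "matroid M" and e: "e \<in> ground M'" and V: "ground N \<subseteq> ground M' - {e}"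
    and N: "matroid N"
    and keeps: "con_keeps (ground M') (rki M') (ground N) (rki N) e"
  shows "has_minor (delete (contract M (insert e C)) D) N"
proof -
  let ?M = "delete (contract M (insert e C)) D"
  have gr: "ground M' = ground M - C - D" "ground ?M = ground M - insert e C - D"
    unfolding M'_def using minor_matroid(2)[OF M] by auto
  obtain B where B: "minor_rep (ground M') (rki M') (ground N) (rki N) B" "e \<in> B"
    using keeps unfolding con_keeps_def by auto
  have r: "rki ?M X = rki M' (insert e X) - rki M' {e}" if "X \<subseteq> ground ?M" for X
    using rki_contract_element[OF M, of X e C D] that gr e unfolding M'_def by auto
  have BE: "B - {e} \<subseteq> ground ?M - ground N" using B gr unfolding minor_rep_def by auto
  have "rki ?M (X \<union> (B - {e})) - rki ?M (B - {e}) = rki N X" if X: "X \<subseteq> ground N" for X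
  proof -
    have "X \<union> (B - {e}) \<subseteq> ground ?M" "B - {e} \<subseteq> ground ?M" using X BE V gr by auto
    moreover have "insert e (X \<union> (B - {e})) = X \<union> B" "insert e (B - {e}) = B" using B by auto
    ultimately show ?thesis using r B(1) X unfolding minor_rep_def by auto
  qed
  then have "minor_rep (ground ?M) (rki ?M) (ground N) (rki N) (B - {e})"
    using BE unfolding minor_rep_def by blast
  moreover have "ground N \<subseteq> ground ?M" using V gr by auto
  ultimately show ?thesis
    using N unfolding has_minor_iff[OF minor_matroid(1)[OF M]] by blast
qed

lemma delete_element_three_connected:
  fixes M :: "'a matroid" and C D
  defines "M' \<equiv> delete (contract M C) D"
  assumes M: "matroid M" and e: "e \<in> ground M'" and t3: "tangle3 (ground M') (rki M') T F"
    and d: "del_3conn (ground M') (rki M') e"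
  shows "three_connected (delete (contract M C) (insert e D))"
  unfolding three_connected_iff
proof (intro conjI allI impI)
  interpret tangle3 "ground M'" "rki M'" T F by (rule t3)
  let ?M = "delete (contract M C) (insert e D)"
  show "matroid ?M" by (rule minor_matroid(1)[OF M])
  have gr: "ground M' = ground M - C - D" "ground ?M = ground M' - {e}"
    unfolding M'_def using minor_matroid(2)[OF M] by auto
  fix X assume X: "X \<subseteq> ground ?M"
  have "rki ?M Y = rki M' Y" if "Y \<subseteq> ground M' - {e}" for Y
    using rki_delete_element[OF M, of Y C e D] that gr unfolding M'_def by auto
  then have c: "connf (ground ?M) (rki ?M) X
      = rki M' X + rki M' (ground M' - {e} - X) - rki M' (ground M' - {e})"
    using X unfolding connf_def gr(2) by (simp add: Diff_subset)
  {
    assume "1 \<le> card X" "1 \<le> card (ground ?M - X)"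
    then have "rki M' (ground M' - {e}) + 1 \<le> rki M' X + rki M' (ground M' - {e} - X)"
      using del_3conn_connected[OF d e, of X] X unfolding gr(2) by blast
    then show "1 \<le> connf (ground ?M) (rki ?M) X" unfolding c by linarith
  next
    assume "2 \<le> card X" "2 \<le> card (ground ?M - X)"
    then have "rki M' (ground M' - {e}) + 2 \<le> rki M' X + rki M' (ground M' - {e} - X)"
      using d X unfolding gr(2) del_3conn_def by blast
    then show "2 \<le> connf (ground ?M) (rki ?M) X" unfolding c by linarith
  }
qed

lemma contract_element_three_connected:
  fixes M :: "'a matroid" and C D
  defines "M' \<equiv> delete (contract M C) D"
  assumes M: "matroid M" and e: "e \<in> ground M'" and t3: "tangle3 (ground M') (rki M') T F"
    and d: "con_3conn (ground M') (rki M') e"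
  shows "three_connected (delete (contract M (insert e C)) D)"
  unfolding three_connected_iff
proof (intro conjI allI impI)
  interpret tangle3 "ground M'" "rki M'" T F by (rule t3)
  let ?M = "delete (contract M (insert e C)) D"
  show "matroid ?M" by (rule minor_matroid(1)[OF M])
  have gr: "ground M' = ground M - C - D" "ground ?M = ground M' - {e}"
    unfolding M'_def using minor_matroid(2)[OF M] by auto
  fix X assume X: "X \<subseteq> ground ?M"
  have "rki ?M Y = rki M' (insert e Y) - rki M' {e}" if "Y \<subseteq> ground M' - {e}" for Y
    using rki_contract_element[OF M, of Y e C D] that gr e unfolding M'_def by auto
  moreover have "insert e (ground M' - {e} - X) = ground M' - X" "insert e (ground M' - {e}) = ground M'"
    using X e gr by auto
  ultimately have c: "connf (ground ?M) (rki ?M) X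
      = rki M' (insert e X) + rki M' (ground M' - X) - rki M' (ground M') - rki M' {e}"
    using X unfolding connf_def gr(2) by (simp add: Diff_subset)
  {
    assume "1 \<le> card X" "1 \<le> card (ground ?M - X)"
    then have "rki M' (ground M') + rki M' {e} + 1 \<le> rki M' (insert e X) + rki M' (ground M' - X)"
      using con_3conn_connected[OF d e, of X] X unfolding gr(2) by blast
    then show "1 \<le> connf (ground ?M) (rki ?M) X" unfolding c by linarith
  next
    assume "2 \<le> card X" "2 \<le> card (ground ?M - X)"
    then have "rki M' (ground M') + rki M' {e} + 2 \<le> rki M' (insert e X) + rki M' (ground M' - X)"
      using d X unfolding gr(2) con_3conn_def by blast
    then show "2 \<le> connf (ground ?M) (rki ?M) X" unfolding c by linarith
  }
qed

section \<open>Tangles\<close>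

locale tangle = rank_fun E r for E :: "'a set" and r +
  fixes \<theta> :: int and T :: "'a set set"
  assumes sub: "X \<in> T \<Longrightarrow> X \<subseteq> E"
    and lt: "X \<in> T \<Longrightarrow> connf E r X < \<theta>"
    and or_compl: "X \<subseteq> E \<Longrightarrow> connf E r X < \<theta> \<Longrightarrow> X \<in> T \<or> E - X \<in> T"
    and cover: "X \<in> T \<Longrightarrow> Y \<in> T \<Longrightarrow> Z \<in> T \<Longrightarrow> X \<union> Y \<union> Z \<noteq> E"
    and co1: "e \<in> E \<Longrightarrow> E - {e} \<notin> T"
begin

lemma subset_mem: "X \<subseteq> Y \<Longrightarrow> Y \<in> T \<Longrightarrow> connf E r X < \<theta> \<Longrightarrow> X \<in> T"
  using or_compl[of X] sub[of Y] cover[of Y "E - X" Y] by blast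

lemma Un_mem: "X \<in> T \<Longrightarrow> Y \<in> T \<Longrightarrow> connf E r (X \<union> Y) < \<theta> \<Longrightarrow> X \<union> Y \<in> T"
  using or_compl[of "X \<union> Y"] sub[of X] sub[of Y] cover[of X Y "E - (X \<union> Y)"] by blast

lemma single_mem: "e \<in> E \<Longrightarrow> 2 \<le> \<theta> \<Longrightarrow> {e} \<in> T"
  using or_compl[of "{e}"] connf_le_card[of "{e}"] co1[of e] by auto

lemma card_mem:
  assumes "X \<subseteq> E" "int (card X) < \<theta>" shows "X \<in> T"
proof -
  have "finite X" using assms(1) fin finite_subset by blast
  then show ?thesis using assms
  proof (induction X rule: finite_induct)
    case empty
    then show ?case
      using or_compl[of "{}"] connf_le_card[of "{}"] cover[of E E E] by auto
  next
    case (insert e X)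
    have "connf E r (insert e X) < \<theta>" using connf_le_card[OF insert.prems(1)] insert.prems(2) by simp
    moreover have "{e} \<in> T" "X \<in> T"
      using insert by (auto intro!: single_mem)
    ultimately show ?case using Un_mem[of "{e}" X] by simp
  qed
qed

text \<open>The closure is taken as a largest member above \<open>Y\<close> whose connectivity does
  not exceed that of \<open>Y\<close>. It serves both for \<open>T\<close> and for the induced
  tangle.\<close>

lemma closed_superset:
  assumes "Y \<in> T"
  shows "\<exists>F \<in> T. Y \<subseteq> F \<and> connf E r F \<le> connf E r Y \<and>
    (\<forall>Z \<in> T. F \<subseteq> Z \<longrightarrow> connf E r Z \<le> connf E r F \<longrightarrow> Z = F)"
proof -
  let ?P = "\<lambda>F. F \<in> T \<and> Y \<subseteq> F \<and> connf E r F \<le> connf E r Y"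
  have "?P Y" using assms by simp
  then obtain F where F: "?P F" and min: "\<And>Z. ?P Z \<Longrightarrow> card (E - F) \<le> card (E - Z)"
    using ex_has_least_nat[of ?P Y "\<lambda>Z. card (E - Z)"] by blast
  have "Z = F" if Z: "Z \<in> T" "F \<subseteq> Z" "connf E r Z \<le> connf E r F" for Z
  proof (rule ccontr)
    assume "Z \<noteq> F"
    then have "E - Z \<subset> E - F" using Z sub[of Z] by blast
    then have "card (E - Z) < card (E - F)" using fin by (intro psubset_card_mono) auto
    moreover have "?P Z" using F Z by auto
    ultimately show False using min[of Z] by simp
  qed
  then show ?thesis using F by blast
qed

context
  fixes C D :: "'a set"
  assumes CD: "C \<subseteq> E" "D \<subseteq> E" "C \<inter> D = {}"
begin

abbreviation "E' \<equiv> E - C - D"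
abbreviation "r' \<equiv> minor_rank r E' C"

lemma finCD: "finite C" "finite D" using CD fin finite_subset by blast+

lemma connf_minor:
  assumes "X \<subseteq> E'"
  shows "connf E' r' X = r (X \<union> C) + r ((E' - X) \<union> C) - r (E - D) - r C"
proof -
  have "X \<inter> E' = X" "(E' - X) \<inter> E' = E' - X" "E' \<inter> E' \<union> C = E - D" using assms CD by auto
  then show ?thesis unfolding connf_def minor_rank_def by simp
qed

lemma connf_le_minor:
  assumes "X \<subseteq> E'"
  shows "connf E r X \<le> connf E' r' X + int (card (C \<union> D))"
proof -
  have "r X \<le> r (X \<union> C)" by (rule r_mono) auto
  moreover have "r (E - X) \<le> r ((E' - X) \<union> C \<union> D)" by (rule r_mono) auto
  moreover have "r ((E' - X) \<union> C \<union> D) \<le> r ((E' - X) \<union> C) + int (card D)" using finCD by (intro r_Un_card)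
  moreover have "r (E - D) \<le> r E" by (rule r_mono) auto
  moreover have "r C \<le> int (card C)" using finCD by (intro r_card)
  moreover have "card (C \<union> D) = card C + card D" using finCD CD by (intro card_Un_disjoint) auto
  ultimately show ?thesis unfolding connf_minor[OF assms] connf_def[of E r X] by simp
qed

lemma connf_Un_le_minor:
  assumes "X \<subseteq> E'"
  shows "connf E r (X \<union> (C \<union> D)) \<le> connf E' r' X + int (card (C \<union> D))"
proof -
  interpret S: rank_fun E' r' by (rule rank_fun_minor) auto
  have "E' - X \<subseteq> E" "E - (E' - X) = X \<union> (C \<union> D)" using assms CD by auto
  then have "connf E r (X \<union> (C \<union> D)) = connf E r (E' - X)" using connf_compl by metis
  then show ?thesis using connf_le_minor[of "E' - X"] S.connf_compl[OF assms] by simp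
qed

lemma connf_minor_le:
  assumes "Y \<subseteq> E"
  shows "connf E' r' (Y - (C \<union> D)) \<le> connf E r Y"
proof -
  let ?X = "Y - (C \<union> D)" and ?W = "(E - D) - Y"
  have X: "?X \<subseteq> E'" using assms by auto
  have "r (Y \<union> (E - D)) + r (Y - D) \<le> r Y + r (E - D)" using assms by (intro r_sub) auto
  moreover have "r E + r ?W \<le> r (E - Y) + r (Y \<union> (E - D))" by (intro r_sub) auto
  moreover have "r (?X \<union> C) + r (C \<inter> Y) \<le> r (Y - D) + r C" using CD by (intro r_sub) auto
  moreover have "r ((E' - ?X) \<union> C) + r (C - Y) \<le> r ?W + r C" using CD by (intro r_sub) auto
  moreover have "r C + r {} \<le> r (C \<inter> Y) + r (C - Y)" by (intro r_sub) auto
  ultimately show ?thesis unfolding connf_minor[OF X] connf_def[of E r Y] using r_empty by linarith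
qed

text \<open>Each removed element lowers connectivity by at most one, so sets below the reduced order
  are below \<open>\<theta>\<close> in the original matroid. The bound on \<open>k\<close> makes
  \<open>C \<union> D\<close> and single elements small. A cover of \<open>E'\<close> then extends
  to one of \<open>E\<close> by adding \<open>C \<union> D\<close> to one of its three sets, which
  stays below \<open>\<theta>\<close>.\<close>

lemma tangle_minor:
  assumes k: "int (card (C \<union> D)) + 2 \<le> \<theta>"
  shows "tangle E' r' (\<theta> - int (card (C \<union> D)))
    {X \<in> T. X \<subseteq> E' \<and> connf E' r' X < \<theta> - int (card (C \<union> D))}"
proof (intro tangle.intro tangle_axioms.intro)
  let ?k = "int (card (C \<union> D))"
  let ?T = "{X \<in> T. X \<subseteq> E' \<and> connf E' r' X < \<theta> - ?k}"
  show "rank_fun E' r'" by (rule rank_fun_minor) auto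
  interpret S: rank_fun E' r' by (rule rank_fun_minor) auto
  have K: "C \<union> D \<in> T" using CD k by (intro card_mem) auto
  show "X \<subseteq> E'" "connf E' r' X < \<theta> - ?k" if "X \<in> ?T" for X using that by auto
  show "X \<in> ?T \<or> E' - X \<in> ?T" if X: "X \<subseteq> E'" "connf E' r' X < \<theta> - ?k" for X
  proof -
    have c: "connf E' r' (E' - X) < \<theta> - ?k" using X S.connf_compl by simp
    have "connf E r X < \<theta>" "connf E r (E' - X) < \<theta>"
      using connf_le_minor[of X] connf_le_minor[of "E' - X"] X c by auto
    moreover have "X \<in> T \<or> E - X \<in> T" using or_compl[of X] X calculation by auto
    ultimately have "X \<in> T \<or> E' - X \<in> T" using subset_mem[of "E' - X" "E - X"] by auto
    then show ?thesis using X c by auto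
  qed
  show "X \<union> Y \<union> Z \<noteq> E'" if XYZ: "X \<in> ?T" "Y \<in> ?T" "Z \<in> ?T" for X Y Z
  proof
    assume U: "X \<union> Y \<union> Z = E'"
    have "X \<subseteq> E'" "connf E' r' X < \<theta> - ?k" using XYZ by auto
    then have "X \<union> (C \<union> D) \<in> T"
      using XYZ connf_Un_le_minor[of X] by (intro Un_mem K) auto
    moreover have "(X \<union> (C \<union> D)) \<union> Y \<union> Z = E" using U CD by blast
    ultimately show False using cover XYZ by blast
  qed
  show "E' - {e} \<notin> ?T" if e: "e \<in> E'" for e
  proof
    assume "E' - {e} \<in> ?T"
    moreover have "{e} \<in> T" using e k by (intro single_mem) auto
    moreover have "(E' - {e}) \<union> {e} \<union> (C \<union> D) = E" using e CD by auto
    ultimately show False using cover K by blast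
  qed
qed

end

end

section \<open>Tangle rank and its closure\<close>

lemma tangle_of_is_tangle:
  assumes M: "matroid M" "is_tangle M \<theta> T"
  shows "tangle (ground M) (rki M) (int \<theta>) T"
proof (intro tangle.intro tangle_axioms.intro)
  note t = M(2)[unfolded is_tangle_def]
  note t1 = t[THEN conjunct1] and t' = t[THEN conjunct2]
  note t2 = t'[THEN conjunct1] and t'' = t'[THEN conjunct2]
  note t3 = t''[THEN conjunct1] and t4 = t''[THEN conjunct2, THEN conjunct1]
    and t5 = t''[THEN conjunct2, THEN conjunct2]
  show "rank_fun (ground M) (rki M)" by (rule rank_fun_rk[OF M(1)])
  show sub: "X \<subseteq> ground M" if "X \<in> T" for X using t1 that by (rule bspec)
  show "connf (ground M) (rki M) X < int \<theta>" if "X \<in> T" for X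
    using conn_connf[OF M(1) sub[OF that]] bspec[OF t2 that] by simp
  show "X \<in> T \<or> ground M - X \<in> T" if "X \<subseteq> ground M" "connf (ground M) (rki M) X < int \<theta>" for X
    using t3[THEN spec, of X] conn_connf[OF M(1) that(1)] that by simp
  show "X \<union> Y \<union> Z \<noteq> ground M" if "X \<in> T" "Y \<in> T" "Z \<in> T" for X Y Z
    using bspec[OF bspec[OF bspec[OF t4 that(1)] that(2)] that(3)] .
  show "ground M - {e} \<notin> T" if "e \<in> ground M" for e using t5 that by (rule bspec)
qed

lemma tangle_rank_set:
  assumes "matroid M" "is_tangle M \<theta> T" "Y \<in> T" "X \<subseteq> Y"
  shows "finite {conn M Y | Y. Y \<in> T \<and> X \<subseteq> Y}" "conn M Y \<in> {conn M Y | Y. Y \<in> T \<and> X \<subseteq> Y}"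
proof -
  have "{conn M Y | Y. Y \<in> T \<and> X \<subseteq> Y} \<subseteq> {..<\<theta>}" using assms(2) unfolding is_tangle_def by auto
  then show "finite {conn M Y | Y. Y \<in> T \<and> X \<subseteq> Y}" using finite_subset by blast
qed (use assms in auto)

lemma tangle_rank_eqI:
  assumes "matroid M" "is_tangle M \<theta> T" "Y \<in> T" "X \<subseteq> Y" "conn M Y \<le> m"
    and "\<And>Z. Z \<in> T \<Longrightarrow> X \<subseteq> Z \<Longrightarrow> m \<le> conn M Z"
  shows "tangle_rank M \<theta> T X = m"
proof -
  have "conn M Y = m" using assms(3-6) by (meson le_antisym)
  then have "Min {conn M Y | Y. Y \<in> T \<and> X \<subseteq> Y} = m"
    using tangle_rank_set[OF assms(1-4)] assms(6) by (intro Min_eqI) auto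
  then show ?thesis using assms(3,4) unfolding tangle_rank_def by auto
qed

lemma tangle_rank_lt:
  assumes "matroid M" "is_tangle M \<theta> T" "tangle_rank M \<theta> T X < \<theta>"
  shows "\<exists>Y \<in> T. X \<subseteq> Y \<and> conn M Y = tangle_rank M \<theta> T X"
    and "Z \<in> T \<Longrightarrow> X \<subseteq> Z \<Longrightarrow> tangle_rank M \<theta> T X \<le> conn M Z"
proof -
  obtain Y where Y: "Y \<in> T" "X \<subseteq> Y" using assms(3) unfolding tangle_rank_def by (auto split: if_splits)
  then have eq: "tangle_rank M \<theta> T X = Min {conn M Y | Y. Y \<in> T \<and> X \<subseteq> Y}"
    unfolding tangle_rank_def by auto
  have "tangle_rank M \<theta> T X \<in> {conn M Y | Y. Y \<in> T \<and> X \<subseteq> Y}"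
    unfolding eq using tangle_rank_set[OF assms(1,2) Y] by (intro Min_in) auto
  then show "\<exists>Y \<in> T. X \<subseteq> Y \<and> conn M Y = tangle_rank M \<theta> T X" by auto
  show "tangle_rank M \<theta> T X \<le> conn M Z" if "Z \<in> T" "X \<subseteq> Z"
    unfolding eq using tangle_rank_set[OF assms(1,2) that] by (intro Min_le) auto
qed

lemma tangle_closure:
  assumes M: "matroid M" "is_tangle M \<theta> T" and X: "X \<subseteq> ground M" "Suc (tangle_rank M \<theta> T X) < \<theta>"
  shows "\<exists>Y \<in> T. X \<subseteq> Y \<and> conn M Y \<le> tangle_rank M \<theta> T X \<and>
    (\<forall>e \<in> ground M - Y. tangle_rank M \<theta> T (insert e X) = Suc (tangle_rank M \<theta> T X))"
proof -
  let ?t = "tangle_rank M \<theta> T X" and ?E = "ground M"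
  interpret tangle ?E "rki M" "int \<theta>" T by (rule tangle_of_is_tangle[OF M])
  have t: "?t < \<theta>" using X by simp
  obtain Y0 where Y0: "Y0 \<in> T" "X \<subseteq> Y0" "conn M Y0 = ?t" using tangle_rank_lt(1)[OF M t] by auto
  obtain Y where Y: "Y \<in> T" "Y0 \<subseteq> Y" "connf ?E (rki M) Y \<le> connf ?E (rki M) Y0"
    and closed: "\<And>Z. Z \<in> T \<Longrightarrow> Y \<subseteq> Z \<Longrightarrow> connf ?E (rki M) Z \<le> connf ?E (rki M) Y \<Longrightarrow> Z = Y"
    using closed_superset[OF Y0(1)] by blast
  note cc = conn_connf[OF M(1)]
  have Yt: "connf ?E (rki M) Y \<le> int ?t" using Y Y0 cc[OF sub[OF Y0(1)]] by simp
  have XY: "X \<subseteq> Y" using Y Y0 by auto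
  \<comment> \<open>A set between \<open>X\<close> and \<open>Y\<close> of smaller connectivity
    would itself be small and would lower the tangle rank of \<open>X\<close>.\<close>
  have low: "int ?t \<le> connf ?E (rki M) Z" if "Z \<subseteq> ?E" "X \<subseteq> Z" "Z \<subseteq> Y" for Z
  proof (rule ccontr)
    assume n: "\<not> ?thesis"
    then have "Z \<in> T" using subset_mem[OF that(3) Y(1)] t by linarith
    then have "?t \<le> conn M Z" using tangle_rank_lt(2)[OF M t] that by auto
    then show False using n cc[OF that(1)] by simp
  qed
  have "tangle_rank M \<theta> T (insert e X) = Suc ?t" if e: "e \<in> ?E - Y" for e
  proof (rule tangle_rank_eqI[OF M])
    have le: "connf ?E (rki M) ({e} \<union> Y) \<le> int ?t + 1" using connf_insert[of e Y] Yt by simp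
    then show "{e} \<union> Y \<in> T" using e X Y by (intro Un_mem single_mem) auto
    show "insert e X \<subseteq> {e} \<union> Y" using XY by auto
    have "{e} \<union> Y \<subseteq> ?E" using e sub[OF Y(1)] by auto
    from cc[OF this] show "conn M ({e} \<union> Y) \<le> Suc ?t" using le by linarith
  next
    fix Z assume Z: "Z \<in> T" "insert e X \<subseteq> Z"
    show "Suc ?t \<le> conn M Z"
    proof (rule ccontr)
      assume "\<not> ?thesis"
      then have "connf ?E (rki M) Z \<le> int ?t" using cc[OF sub[OF Z(1)]] by simp
      \<comment> \<open>As \<open>Y \<inter> Z\<close> has connectivity at least \<open>?t\<close>,
        submodularity bounds that of \<open>Y \<union> Z\<close> by that of \<open>Y\<close>.
        Closedness of \<open>Y\<close> then absorbs \<open>Z\<close>, although \<open>e\<close> is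
        outside \<open>Y\<close>.\<close>
      moreover have "int ?t \<le> connf ?E (rki M) (Y \<inter> Z)"
        using Z XY sub[OF Y(1)] by (intro low) auto
      ultimately have c: "connf ?E (rki M) (Y \<union> Z) \<le> connf ?E (rki M) Y"
        using connf_submod[of Y Z] by linarith
      then have "Y \<union> Z \<in> T" using Yt t by (intro Un_mem Y(1) Z(1)) linarith
      then have "Y \<union> Z = Y" using closed c by blast
      then show False using Z e by auto
    qed
  qed
  moreover have "conn M Y \<le> ?t" using Yt cc[OF sub[OF Y(1)]] by simp
  ultimately show ?thesis using Y XY by blast
qed

section \<open>One removal, and the induction on the number of removals\<close>

lemma tangle_step:
  fixes M N :: "'a matroid" and C D
  defines "M' \<equiv> delete (contract M C) D" and "k \<equiv> card (C \<union> D)"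
  assumes M: "matroid M" and T: "is_tangle M \<theta> T"
    and CD: "C \<subseteq> ground M - ground N" "D \<subseteq> ground M - ground N" "C \<inter> D = {}"
    and t3: "three_connected M'" and N: "has_minor M' N"
    and loops: "\<forall>e. \<not> is_loop N e" "\<forall>e. \<not> is_coloop N e"
    and rank: "tangle_rank M \<theta> T (ground N \<union> C \<union> D) = t + k" and big: "t + 2 * k + 3 \<le> \<theta>"
  shows "\<exists>e \<in> ground M - ground N - C - D.
    tangle_rank M \<theta> T (insert e (ground N \<union> C \<union> D)) = Suc (t + k) \<and>
    (three_connected (delete (contract M C) (insert e D)) \<and> has_minor (delete (contract M C) (insert e D)) N \<or>
     three_connected (delete (contract M (insert e C)) D) \<and> has_minor (delete (contract M (insert e C)) D) N)"
proof (rule ccontr)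
  assume stuck: "\<not> ?thesis"
  let ?E = "ground M" and ?E' = "ground M'" and ?V = "ground N"
  have E': "?E' = ?E - C - D" unfolding M'_def by (rule minor_matroid(2)[OF M])
  have r': "rki M' = minor_rank (rki M) (?E - C - D) C"
    unfolding M'_def using minor_matroid(3)[OF M] by blast
  have M': "matroid M'" unfolding M'_def by (rule minor_matroid(1)[OF M])
  have Nm: "matroid N" and VE': "?V \<subseteq> ?E'" and rep: "\<exists>B. minor_rep ?E' (rki M') ?V (rki N) B"
    using N has_minor_iff[OF M'] by auto
  interpret M: tangle ?E "rki M" "int \<theta>" T by (rule tangle_of_is_tangle[OF M T])
  have CDE: "C \<subseteq> ?E" "D \<subseteq> ?E" "C \<inter> D = {}" using CD by auto
  define T' where "T' = {X \<in> T. X \<subseteq> ?E' \<and> connf ?E' (rki M') X < int \<theta> - int k}"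
  interpret M': tangle ?E' "rki M'" "int \<theta> - int k" T'
    using M.tangle_minor[OF CDE] big unfolding T'_def r' E' k_def by simp
  have "?V \<union> C \<union> D \<subseteq> ?E" using VE' E' CDE by auto
  then obtain Y where Y: "Y \<in> T" "?V \<union> C \<union> D \<subseteq> Y" "conn M Y \<le> t + k"
    and up: "\<And>e. e \<in> ?E - Y \<Longrightarrow> tangle_rank M \<theta> T (insert e (?V \<union> C \<union> D)) = Suc (t + k)"
    using tangle_closure[OF M T, of "?V \<union> C \<union> D"] rank big by auto
  let ?Y = "Y - (C \<union> D)"
  have YE: "Y \<subseteq> ?E" using M.sub[OF Y(1)] .
  have YE': "?Y \<subseteq> ?E'" using YE E' by auto
  have cY: "connf ?E' (rki M') ?Y \<le> int (t + k)"
    using M.connf_minor_le[OF CDE YE] Y(3) conn_connf[OF M YE] unfolding r' E' by simp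
  then have "connf ?E (rki M) ?Y < int \<theta>"
    using M.connf_le_minor[OF CDE, of ?Y] YE' big unfolding r' E' k_def by simp
  then have "?Y \<in> T" using M.subset_mem[of ?Y Y] Y by auto
  then have "?Y \<in> T'" using YE' cY big unfolding T'_def by simp
  then obtain F where F: "F \<in> T'" "?Y \<subseteq> F"
    and closed: "\<And>Z. Z \<in> T' \<Longrightarrow> F \<subseteq> Z \<Longrightarrow> connf ?E' (rki M') Z \<le> connf ?E' (rki M') F \<Longrightarrow> Z = F"
    using M'.closed_superset[of ?Y] by blast
  have three: "3 \<le> int \<theta> - int k" using big by simp
  have tg: "tangle3 ?E' (rki M') T' F"
  proof (intro tangle3.intro tangle3_axioms.intro)
    show "rank_fun ?E' (rki M')" by (rule rank_fun_rk[OF M'])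
    show "2 \<le> connf ?E' (rki M') X" if "X \<subseteq> ?E'" "2 \<le> card X" "2 \<le> card (?E' - X)" for X
      using t3 that unfolding three_connected_iff by blast
    show "X \<in> T' \<or> ?E' - X \<in> T'" if "X \<subseteq> ?E'" "connf ?E' (rki M') X \<le> 2" for X
      using M'.or_compl[of X] that three by linarith
  qed (use M'.sub M'.cover M'.co1 F in blast)+
  interpret G: tangle3 ?E' "rki M'" T' F by (rule tg)
  have e_new: "e \<in> ?E - ?V - C - D" "e \<in> ?E - Y" "e \<in> ?E'" "?V \<subseteq> ?E' - {e}" if "e \<in> ?E' - F" for e
    using that F Y E' VE' by auto
  have "stuck_minor ?E' (rki M') T' F ?V (rki N)"
  proof (intro stuck_minor.intro stuck_minor_axioms.intro)
    show "tangle3 ?E' (rki M') T' F" by (rule tg)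
    show "rank_fun ?V (rki N)" by (rule rank_fun_rk[OF Nm])
    show "?V \<subseteq> F" using Y(2) F(2) VE' E' by auto
    show "L \<subseteq> F" if L: "L \<in> T'" "connf ?E' (rki M') L \<le> 2" "2 \<le> card (L \<inter> F)" for L
    proof -
      have LE: "L \<inter> F \<subseteq> ?E'" using M'.sub[OF L(1)] by auto
      have "card (?E' - L) \<le> card (?E' - L \<inter> F)" using M'.fin by (intro card_mono) auto
      then have "2 \<le> card (?E' - L \<inter> F)" using G.T_compl_big[OF L(1)] by simp
      \<comment> \<open>The intersection is as connected as \<open>L\<close> can be, so by
        submodularity \<open>L \<union> F\<close> is no more connected than \<open>F\<close>, and
        closedness of \<open>F\<close> forces equality.\<close>
      then have "2 \<le> connf ?E' (rki M') (L \<inter> F)" using G.conn3[OF LE L(3)] by simp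
      then have c: "connf ?E' (rki M') (L \<union> F) \<le> connf ?E' (rki M') F"
        using M'.connf_submod[of L F] L(2) by linarith
      then have "L \<union> F \<in> T'" using M'.lt[OF F(1)] by (intro M'.Un_mem L(1) F(1)) linarith
      then show ?thesis using closed[of "L \<union> F"] c by auto
    qed
    show "1 \<le> rki N {x}" if "x \<in> ?V" for x
    proof -
      have "indep N {x}" using loops(1) that unfolding is_loop_def by blast
      then show ?thesis using indep_iff_rk[OF Nm] by auto
    qed
    show "rki N ?V \<le> rki N (?V - {x})" if "x \<in> ?V" for x
      using loops(2) that unfolding is_coloop_def matroid_rank_def by (meson not_le of_nat_mono)
    show "\<exists>B. minor_rep ?E' (rki M') ?V (rki N) B" by (rule rep)
    show "\<not> del_3conn ?E' (rki M') e" if e: "e \<in> ?E' - F" "del_keeps ?E' (rki M') ?V (rki N) e" for e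
    proof
      assume "del_3conn ?E' (rki M') e"
      then have "three_connected (delete (contract M C) (insert e D))"
        using delete_element_three_connected[OF M, of e C D] e_new[OF e(1)] tg unfolding M'_def by blast
      moreover have "has_minor (delete (contract M C) (insert e D)) N"
        using delete_element_minor[OF M, of e C D N] e_new[OF e(1)] Nm e(2) unfolding M'_def by blast
      ultimately show False using stuck up e_new[OF e(1)] by blast
    qed
    show "\<not> con_3conn ?E' (rki M') e" if e: "e \<in> ?E' - F" "con_keeps ?E' (rki M') ?V (rki N) e" for e
    proof
      assume "con_3conn ?E' (rki M') e"
      then have "three_connected (delete (contract M (insert e C)) D)"
        using contract_element_three_connected[OF M, of e C D] e_new[OF e(1)] tg unfolding M'_def by blast
      moreover have "has_minor (delete (contract M (insert e C)) D) N"
        using contract_element_minor[OF M, of e C D N] e_new[OF e(1)] Nm e(2) unfolding M'_def by blast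
      ultimately show False using stuck up e_new[OF e(1)] by blast
    qed
  qed
  then show False by (rule stuck_minor.stuck_False)
qed

theorem theorem3p2:
  fixes s :: int and \<theta> :: nat and M N :: "'a matroid" and T :: "'a set set"
  assumes "matroid M"
    and "three_connected M"
    and "is_tangle M \<theta> T"
    and "\<theta> \<ge> 6"
    and "has_minor M N"
    and "\<forall>e. \<not> is_loop N e"
    and "\<forall>e. \<not> is_coloop N e"
    and "int \<theta> \<ge> 2 * s + int (tangle_rank M \<theta> T (ground N)) + 1"
  shows "\<exists>C D. C \<subseteq> ground M - ground N \<and> D \<subseteq> ground M - ground N \<and> C \<inter> D = {} \<and>
           three_connected (delete (contract M C) D) \<and>
           has_minor (delete (contract M C) D) N \<and>
           tangle_rank M \<theta> T (ground N \<union> C \<union> D)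
             = tangle_rank M \<theta> T (ground N) + card (C \<union> D) \<and>
           int (card (C \<union> D)) \<ge> s"
proof -
  let ?t = "tangle_rank M \<theta> T (ground N)"
  let ?P = "\<lambda>C D. C \<subseteq> ground M - ground N \<and> D \<subseteq> ground M - ground N \<and> C \<inter> D = {} \<and>
    three_connected (delete (contract M C) D) \<and> has_minor (delete (contract M C) D) N \<and>
    tangle_rank M \<theta> T (ground N \<union> C \<union> D) = ?t + card (C \<union> D)"
  have fin: "finite (ground M)" using matroidD(1)[OF assms(1)] .
  \<comment> \<open>Since \<open>s\<close> may be negative, the count runs up to
    \<open>max 0 s\<close>, which matches \<open>nat s\<close> at the end.\<close>
  have "\<exists>C D. ?P C D \<and> card (C \<union> D) = n" if "int n \<le> max 0 s" for n
    using that
  proof (induction n)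
    case 0
    interpret rank_fun "ground M" "rki M" by (rule rank_fun_rk[OF assms(1)])
    have "rki (delete (contract M {}) {}) X = rki M X" if "X \<subseteq> ground M" for X
      using minor_matroid(3)[OF assms(1), of "{}" "{}" X] that r_empty
      unfolding minor_rank_def by (simp add: Int_absorb2)
    then have "delete (contract M {}) {} = M"
      using minor_matroid(1,2)[OF assms(1), of "{}" "{}"] assms(1) by (intro matroid_eqI) auto
    then show ?case using assms by (intro exI[of _ "{}"]) auto
  next
    case (Suc n)
    have ns: "int n < s" using Suc.prems by (simp add: max_def split: if_splits)
    then have "int n \<le> max 0 s" by simp
    from Suc.IH[OF this] obtain C D where P: "?P C D" and n: "card (C \<union> D) = n" by blast
    \<comment> \<open>From \<open>n + 1 \<le> s\<close> the hypothesis gives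
      \<open>2 * (n + 1) + ?t + 1 \<le> \<theta>\<close>, whence the constant 3.\<close>
    have big: "?t + 2 * card (C \<union> D) + 3 \<le> \<theta>" using ns n assms(8) by linarith
    have "\<exists>e \<in> ground M - ground N - C - D.
      tangle_rank M \<theta> T (insert e (ground N \<union> C \<union> D)) = Suc (?t + card (C \<union> D)) \<and>
      (three_connected (delete (contract M C) (insert e D)) \<and>
         has_minor (delete (contract M C) (insert e D)) N \<or>
       three_connected (delete (contract M (insert e C)) D) \<and>
         has_minor (delete (contract M (insert e C)) D) N)"
      using P big by (intro tangle_step assms) auto
    then obtain e where e: "e \<in> ground M - ground N - C - D"
      "tangle_rank M \<theta> T (insert e (ground N \<union> C \<union> D)) = Suc (?t + card (C \<union> D))"
      and or: "three_connected (delete (contract M C) (insert e D)) \<and>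
         has_minor (delete (contract M C) (insert e D)) N \<or>
       three_connected (delete (contract M (insert e C)) D) \<and>
         has_minor (delete (contract M (insert e C)) D) N" by blast
    have "finite (C \<union> D)" using P fin finite_subset[of "C \<union> D" "ground M"] by blast
    then have c: "card (insert e (C \<union> D)) = Suc n" using e n by simp
    have sets: "C \<union> insert e D = insert e (C \<union> D)" "insert e C \<union> D = insert e (C \<union> D)"
      "ground N \<union> C \<union> insert e D = insert e (ground N \<union> C \<union> D)"
      "ground N \<union> insert e C \<union> D = insert e (ground N \<union> C \<union> D)" by auto
    from or show ?case
    proof
      assume "three_connected (delete (contract M C) (insert e D)) \<and>
         has_minor (delete (contract M C) (insert e D)) N"
      then have "?P C (insert e D) \<and> card (C \<union> insert e D) = Suc n"
        using P e c n unfolding sets by auto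
      then show ?thesis by blast
    next
      assume "three_connected (delete (contract M (insert e C)) D) \<and>
         has_minor (delete (contract M (insert e C)) D) N"
      then have "?P (insert e C) D \<and> card (insert e C \<union> D) = Suc n"
        using P e c n unfolding sets by auto
      then show ?thesis by blast
    qed
  qed
  from this[of "nat s"] have "\<exists>C D. ?P C D \<and> card (C \<union> D) = nat s" by (simp add: max_def)
  then obtain C D where "?P C D" "card (C \<union> D) = nat s" by blast
  then show ?thesis by (intro exI[of _ C] exI[of _ D]) auto
qed

end
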